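(* Let $a_9(n)$ be defined by \[\sum_{n\geq 0}a_9(n)q^n=\frac{f_9f_{18}}{f_1f_2},\qquad f_k=\prod_{m=1}^{\infty}(1-q^{km}).\] Then for every integer $\alpha\geq 0$ and every integer $n\geq 0$, \[a_9\left(3^{\alpha+1}n+3^{\alpha+1}-1\right)\equiv 0 \pmod{3^{\alpha+1}}.\]
   Context: $a_9(n)$ is the number of 9-regular cubic partitions of $n$; its generating function is as given, where $f_k=(q^k;q^k)_\infty$. *)

theory Defs
  imports "HOL-Computational_Algebra.Formal_Power_Series"
begin

definition f :: "nat \<Rightarrow> int fps" where
  "f k = lim (\<lambda>N. \<Prod>m\<in>{1..N}. (1 - fps_X ^ (k * m)))"

text \<open>Generating function of a_9: the unique series A with A * f_1 * f_2 = f_9 * f_18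
  (i.e. A = f_9 f_18 / (f_1 f_2); f_1 f_2 has constant term 1, so it is invertible).\<close>
definition a9_gf :: "int fps" where
  "a9_gf = (THE A. A * (f 1 * f 2) = f 9 * f 18)"

definition a9 :: "nat \<Rightarrow> int" where
  "a9 n = fps_nth a9_gf n"

end

theory Submission
  imports Defs
begin

text \<open>
  Let \<open>U\<close> keep the coefficients of index divisible by 3, so that \<open>U(g(q\<^sup>3) h) = g U(h)\<close>, and put
  \<open>Z = q f\<^sub>9 f\<^sub>1\<^sub>8 / (f\<^sub>1 f\<^sub>2)\<close> and \<open>T = q f\<^sub>3\<^sup>4 f\<^sub>6\<^sup>4 / (f\<^sub>1\<^sup>4 f\<^sub>2\<^sup>4)\<close>. The coefficient of \<open>q\<^sup>m\<close> in \<open>Z\<close> is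
  \<open>a\<^sub>9(m - 1)\<close>, so the claim is that \<open>U\<close> applied \<open>\<alpha> + 1\<close> times to \<open>Z\<close> is divisible by \<open>3\<close> to the power
  \<open>\<alpha> + 1\<close>.

  Since \<open>f\<^sub>1 f\<^sub>2 = \<phi>(-q) \<psi>(q)\<close>, the 3-dissections of the two theta series give
  \<open>f\<^sub>1 f\<^sub>2 = a(q\<^sup>3) - q f\<^sub>9 f\<^sub>1\<^sub>8 - 2 q\<^sup>2 c(q\<^sup>3)\<close> with \<open>a c = f\<^sub>3\<^sup>2 f\<^sub>6\<^sup>2\<close>. Comparing with the product of the
  three conjugates of \<open>f\<^sub>1 f\<^sub>2\<close> under \<open>q \<mapsto> \<omega> q\<close>, \<open>\<omega>\<^sup>3 = 1\<close>, yields
  \<open>Z\<^sup>3 = T(q\<^sup>3)(1 + 3Z + 9Z\<^sup>2)\<close> and \<open>T = Z + 3Z\<^sup>2 + 9Z\<^sup>3\<close>, as well as \<open>U Z = 3T\<close> and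
  \<open>U Z\<^sup>2 = 2T + 27T\<^sup>2\<close>. In terms of \<open>t = 9T\<close> it follows that \<open>U\<close> maps \<open>t \<int>[t]\<close> into \<open>3t \<int>[t]\<close>, while
  \<open>U Z = t/3\<close>.
\<close>

section \<open>Infinite products of formal power series\<close>

text \<open>Convergence means that each coefficient is eventually constant, and coefficient
  \<open>n\<close> of a product involves only finitely many coefficients of the factors.\<close>

lemma tendsto_fps_mult:
  fixes u v :: "'b \<Rightarrow> 'a::ring_1 fps"
  assumes "(u \<longlongrightarrow> a) F" "(v \<longlongrightarrow> b) F"
  shows "((\<lambda>x. u x * v x) \<longlongrightarrow> a * b) F"
proof (rule tendsto_fpsI)
  fix n
  have "\<forall>\<^sub>F x in F. \<forall>i\<in>{..n}. fps_nth (u x) i = fps_nth a i"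
    using assms(1) by (subst eventually_ball_finite_distrib) (auto simp: tendsto_fps_iff)
  moreover have "\<forall>\<^sub>F x in F. \<forall>i\<in>{..n}. fps_nth (v x) i = fps_nth b i"
    using assms(2) by (subst eventually_ball_finite_distrib) (auto simp: tendsto_fps_iff)
  ultimately show "\<forall>\<^sub>F x in F. fps_nth (u x * v x) n = fps_nth (a * b) n"
    by eventually_elim (auto simp: fps_mult_nth intro!: sum.cong)
qed

lemma fps_mult_nth_eq_of_trivial:
  fixes p u :: "'a::ring_1 fps"
  assumes "\<And>i. i \<le> n \<Longrightarrow> fps_nth u i = fps_nth 1 i"
  shows "fps_nth (p * u) n = fps_nth p n"
proof -
  have "fps_nth (p * u) n = fps_nth (p * 1) n"
    unfolding fps_mult_nth using assms by (intro sum.cong) auto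
  thus ?thesis by simp
qed

text \<open>Factor \<open>u j\<close> agrees with 1 up to index \<open>j\<close>, so the factors
  with \<open>j \<ge> i\<close> leave coefficient \<open>i\<close> unchanged.\<close>

lemma fps_prod_nth_stable:
  fixes u :: "nat \<Rightarrow> 'a::comm_ring_1 fps"
  assumes "\<And>j i. i \<le> j \<Longrightarrow> fps_nth (u j) i = fps_nth 1 i" "i \<le> m" "m \<le> n"
  shows "fps_nth (\<Prod>j<n. u j) i = fps_nth (\<Prod>j<m. u j) i"
  using assms(3)
proof (induction n rule: dec_induct)
  case (step n)
  have "fps_nth ((\<Prod>j<n. u j) * u n) i = fps_nth (\<Prod>j<n. u j) i"
    using step.hyps assms(1,2) by (intro fps_mult_nth_eq_of_trivial) auto
  thus ?case using step.IH by simp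
qed auto

lemma fps_prod_convergent:
  fixes u :: "nat \<Rightarrow> 'a::comm_ring_1 fps"
  assumes "\<And>j i. i \<le> j \<Longrightarrow> fps_nth (u j) i = fps_nth 1 i"
  shows "(\<lambda>n. \<Prod>j<n. u j) \<longlonglongrightarrow> lim (\<lambda>n. \<Prod>j<n. u j)"
proof -
  have "(\<lambda>n. \<Prod>j<n. u j) \<longlonglongrightarrow> Abs_fps (\<lambda>i. fps_nth (\<Prod>j<i. u j) i)"
  proof (rule tendsto_fpsI)
    fix i
    show "\<forall>\<^sub>F n in sequentially. fps_nth (\<Prod>j<n. u j) i = fps_nth (Abs_fps (\<lambda>i. fps_nth (\<Prod>j<i. u j) i)) i"
      using eventually_ge_at_top[of i]
    proof eventually_elim
      case (elim n)
      have "fps_nth (\<Prod>j<n. u j) i = fps_nth (\<Prod>j<i. u j) i"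
        by (rule fps_prod_nth_stable[OF assms order.refl elim])
      thus ?case by simp
    qed
  qed
  thus ?thesis by (simp add: limI)
qed

text \<open>The q-Pochhammer symbol (-c q^r; q^s)_infinity. The value \<open>c = -1\<close> gives
  the factors of \<open>f k\<close>, and \<open>c = 1\<close> the factors 1 + q^j of theta series
  with positive sign.\<close>

definition qpoch :: "int \<Rightarrow> nat \<Rightarrow> nat \<Rightarrow> int fps" where
  "qpoch c r s = lim (\<lambda>n. \<Prod>j<n. 1 + fps_const c * fps_X ^ (r + s * j))"

lemma fps_const_minus_1: "fps_const (-1) = (-1 :: 'a::ring_1 fps)"
  by (simp add: fps_eq_iff)

lemma qpoch_factor_nth:
  assumes "r > 0" "s > 0" "i \<le> j"
  shows "fps_nth (1 + fps_const c * fps_X ^ (r + s * j)) i = fps_nth (1 :: int fps) i"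
proof -
  have "1 * j \<le> s * j" using assms by (intro mult_right_mono) auto
  hence "i < r + s * j" using assms by linarith
  thus ?thesis by simp
qed

lemma qpoch_tendsto:
  assumes "r > 0" "s > 0"
  shows "(\<lambda>n. \<Prod>j<n. 1 + fps_const c * fps_X ^ (r + s * j)) \<longlonglongrightarrow> qpoch c r s"
  unfolding qpoch_def by (rule fps_prod_convergent) (use qpoch_factor_nth assms in auto)

lemma fps_prod_nth_0:
  fixes u :: "'b \<Rightarrow> 'a::comm_ring_1 fps"
  shows "fps_nth (\<Prod>i\<in>I. u i) 0 = (\<Prod>i\<in>I. fps_nth (u i) 0)"
  by (induction I rule: infinite_finite_induct) auto

lemma qpoch_nth_0:
  assumes "r > 0" "s > 0"
  shows "fps_nth (qpoch c r s) 0 = 1"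
proof -
  have "\<forall>\<^sub>F n in sequentially. fps_nth (\<Prod>j<n. 1 + fps_const c * fps_X ^ (r + s * j)) 0 = fps_nth (qpoch c r s) 0"
    using qpoch_tendsto[OF assms] unfolding tendsto_fps_iff by blast
  then obtain n where "fps_nth (\<Prod>j<n. 1 + fps_const c * fps_X ^ (r + s * j)) 0 = fps_nth (qpoch c r s) 0"
    by (auto simp: eventually_sequentially)
  thus ?thesis using assms by (simp add: fps_prod_nth_0)
qed

lemma prod_lessThan_mult:
  fixes g :: "nat \<Rightarrow> 'a::comm_monoid_mult"
  shows "(\<Prod>j<m * n. g j) = (\<Prod>i<m. \<Prod>j<n. g (i + m * j))"
proof -
  have "(\<Prod>j<m * n. g j) = (\<Prod>j<n. \<Prod>i<m. g (i + m * j))"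
  proof (induction n)
    case (Suc n)
    have "(\<Prod>j<m * Suc n. g j) = (\<Prod>j<m * n. g j) * (\<Prod>j = m * n..<m * n + m. g j)"
      by (simp add: prod.atLeastLessThan_concat add.commute flip: atLeast0LessThan)
    also have "(\<Prod>j = m * n..<m * n + m. g j) = (\<Prod>i<m. g (i + m * n))"
      using prod.shift_bounds_nat_ivl[of g 0 "m * n" m] by (simp add: atLeast0LessThan add.commute)
    finally show ?case using Suc.IH by simp
  qed simp
  thus ?thesis by (simp add: prod.swap[of _ "{..<n}"])
qed

lemma tendsto_fps_prod:
  fixes u :: "'b \<Rightarrow> 'c \<Rightarrow> 'a::comm_ring_1 fps"
  assumes "\<And>i. i \<in> I \<Longrightarrow> (u i \<longlongrightarrow> a i) F"
  shows "((\<lambda>x. \<Prod>i\<in>I. u i x) \<longlongrightarrow> (\<Prod>i\<in>I. a i)) F"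
  using assms by (induction I rule: infinite_finite_induct) (auto intro: tendsto_fps_mult)

text \<open>The factors are grouped by their index modulo \<open>m\<close>. The limit is taken along
  multiples of \<open>m\<close>, where the finite products split exactly.\<close>

lemma qpoch_split:
  assumes "r > 0" "s > 0" "m > 0"
  shows "qpoch c r s = (\<Prod>i<m. qpoch c (r + s * i) (s * m))"
proof (rule LIMSEQ_unique)
  have "filterlim (\<lambda>n. m * n) at_top sequentially"
    using assms by (intro filterlim_subseq strict_monoI) auto
  thus "(\<lambda>n. \<Prod>j<m * n. 1 + fps_const c * fps_X ^ (r + s * j)) \<longlonglongrightarrow> qpoch c r s"
    by (rule filterlim_compose[OF qpoch_tendsto[OF assms(1,2)]])
  show "(\<lambda>n. \<Prod>j<m * n. 1 + fps_const c * fps_X ^ (r + s * j)) \<longlonglongrightarrow> (\<Prod>i<m. qpoch c (r + s * i) (s * m))"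
    unfolding prod_lessThan_mult
    by (intro tendsto_fps_prod)
       (use qpoch_tendsto[of "r + s * i" "s * m" c for i] assms in \<open>simp add: algebra_simps\<close>)
qed

lemma qpoch_plus_minus:
  assumes "r > 0" "s > 0"
  shows "qpoch 1 r s * qpoch (-1) r s = qpoch (-1) (2 * r) (2 * s)"
proof (rule LIMSEQ_unique)
  show "(\<lambda>n. (\<Prod>j<n. 1 + fps_const 1 * fps_X ^ (r + s * j)) * (\<Prod>j<n. 1 + fps_const (-1) * fps_X ^ (r + s * j)))
      \<longlonglongrightarrow> qpoch 1 r s * qpoch (-1) r s"
    by (intro tendsto_fps_mult qpoch_tendsto assms)
  have "(1 :: int fps) - fps_X ^ (2 * r + 2 * s * j) = (1 + fps_X ^ (r + s * j)) * (1 - fps_X ^ (r + s * j))" for j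
    proof -
    have "(fps_X ^ (r + s * j))\<^sup>2 = (fps_X ^ (2 * r + 2 * s * j) :: int fps)"
      by (simp add: algebra_simps flip: power_mult)
    thus ?thesis by (simp add: algebra_simps power2_eq_square)
  qed
  hence "(\<Prod>j<n. 1 + fps_const 1 * fps_X ^ (r + s * j)) * (\<Prod>j<n. 1 + fps_const (-1) * fps_X ^ (r + s * j))
     = (\<Prod>j<n. 1 + fps_const (-1 :: int) * fps_X ^ (2 * r + 2 * s * j))" for n
    by (simp add: prod.distrib fps_const_minus_1)
  thus "(\<lambda>n. (\<Prod>j<n. 1 + fps_const 1 * fps_X ^ (r + s * j)) * (\<Prod>j<n. 1 + fps_const (-1) * fps_X ^ (r + s * j)))
     \<longlonglongrightarrow> qpoch (-1) (2 * r) (2 * s)"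
    using qpoch_tendsto[of "2 * r" "2 * s" "-1"] assms by simp
qed

lemma f_eq_qpoch: "f k = qpoch (-1) k k"
proof -
  have "(\<Prod>m\<in>{1..N}. (1 - fps_X ^ (k * m))) = (\<Prod>j<N. 1 + fps_const (-1 :: int) * fps_X ^ (k + k * j))" for N
    by (rule prod.reindex_bij_witness[of _ Suc "\<lambda>m. m - 1"])
       (auto simp: algebra_simps Suc_le_eq gr0_conv_Suc fps_const_minus_1)
  thus ?thesis by (simp add: f_def qpoch_def)
qed

lemma f_neq_0: "k > 0 \<Longrightarrow> f k \<noteq> 0"
  using qpoch_nth_0[of k k "-1"] by (auto simp: f_eq_qpoch)

lemma f_nth_0: "k > 0 \<Longrightarrow> fps_nth (f k) 0 = 1"
  by (simp add: f_eq_qpoch qpoch_nth_0)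

section \<open>The Jacobi triple product\<close>

text \<open>Gaussian binomial coefficients, given by a q-Pascal rule so that \<open>q\<close> may be
  any ring element and nothing is divided.\<close>

fun qbinom :: "'a::comm_ring_1 \<Rightarrow> nat \<Rightarrow> nat \<Rightarrow> 'a" where
  "qbinom q n 0 = 1"
| "qbinom q 0 (Suc k) = 0"
| "qbinom q (Suc n) (Suc k) = qbinom q n k + q ^ Suc k * qbinom q n (Suc k)"

lemma qbinom_eq_0: "n < k \<Longrightarrow> qbinom q n k = 0"
  by (induction q n k rule: qbinom.induct) auto

text \<open>The mirror image of the defining q-Pascal rule. In the finite triple product this one
  extends the first product and the defining rule extends the second.\<close>

lemma qbinom_Suc_Suc':
  "k \<le> n \<Longrightarrow> qbinom q (Suc n) (Suc k) = q ^ (n - k) * qbinom q n k + qbinom q n (Suc k)"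
proof (induction n arbitrary: k)
  case (Suc n)
  show ?case
  proof (cases k)
    case 0
    have "qbinom q (Suc n) (Suc 0) = q ^ n + qbinom q n (Suc 0)"
      using Suc.IH[of 0] by simp
    hence "1 + q * qbinom q (Suc n) (Suc 0) = q ^ Suc n + qbinom q (Suc n) (Suc 0)"
      by (simp add: algebra_simps)
    thus ?thesis using 0 by simp
  next
    case [simp]: (Suc k')
    have IH1: "qbinom q (Suc n) (Suc k') = q ^ (n - k') * qbinom q n k' + qbinom q n (Suc k')"
      using Suc.IH[of k'] Suc.prems by simp
    have IH2: "q ^ (k' + 2) * qbinom q (Suc n) (Suc (Suc k'))
      = q ^ (n - k') * q ^ Suc k' * qbinom q n (Suc k') + q ^ (k' + 2) * qbinom q n (Suc (Suc k'))"
    proof (cases "k' < n")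
      case True
      hence "q ^ (k' + 2) * q ^ (n - Suc k') = q ^ (n - k') * q ^ Suc k'"
        unfolding power_add[symmetric] by (intro arg_cong[of _ _ "power q"]) simp
      thus ?thesis using Suc.IH[of "Suc k'"] True by (simp add: algebra_simps)
    next
      case False
      thus ?thesis by (simp add: qbinom_eq_0)
    qed
    have "qbinom q (Suc (Suc n)) (Suc k) = qbinom q (Suc n) (Suc k') + q ^ (k' + 2) * qbinom q (Suc n) (Suc (Suc k'))"
      by simp
    also have "\<dots> = q ^ (Suc n - k) * qbinom q (Suc n) k + qbinom q (Suc n) (Suc k)"
      unfolding IH1 IH2 by (simp add: algebra_simps)
    finally show ?thesis .
  qed
qed simp

text \<open>The quotient formula cleared of denominators. The two Pascal terms combine because (1 -
  q^k) + q^k (1 - q^(n+1-k)) = 1 - q^(n+1).\<close>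

lemma qbinom_mult:
  "k \<le> n \<Longrightarrow> qbinom q n k * (\<Prod>i<k. 1 - q ^ Suc i) * (\<Prod>i<n - k. 1 - q ^ Suc i) = (\<Prod>i<n. 1 - q ^ Suc i)"
proof (induction n arbitrary: k)
  case (Suc n)
  show ?case
  proof (cases k)
    case [simp]: (Suc k')
    define P where "P = (\<lambda>m. \<Prod>i<m. 1 - q ^ Suc i)"
    have P_Suc: "P (Suc m) = P m * (1 - q ^ Suc m)" for m by (simp add: P_def)
    have IH1: "qbinom q n k' * P k' * P (n - k') = P n"
      using Suc.IH[of k'] Suc.prems by (simp add: P_def)
    have IH2: "qbinom q n (Suc k') * P (Suc k') * P (n - k') = (1 - q ^ (n - k')) * P n"
    proof (cases "k' < n")
      case True
      hence "n - k' = Suc (n - Suc k')" by simp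
      hence "P (n - k') = P (n - Suc k') * (1 - q ^ (n - k'))" by (metis P_Suc)
      moreover have "qbinom q n (Suc k') * P (Suc k') * P (n - Suc k') = P n"
        using Suc.IH[of "Suc k'"] True by (simp add: P_def)
      ultimately show ?thesis by (metis mult.assoc mult.commute)
    next
      case False
      thus ?thesis using Suc.prems by (simp add: qbinom_eq_0)
    qed
    have "q ^ Suc k' * q ^ (n - k') = q ^ Suc n"
      unfolding power_add[symmetric] using Suc.prems by (intro arg_cong[of _ _ "power q"]) simp
    hence *: "(1 - q ^ Suc k') + q ^ Suc k' * (1 - q ^ (n - k')) = 1 - q ^ Suc n"
      by (simp add: algebra_simps)
    have "qbinom q (Suc n) k * P k * P (Suc n - k)
       = (1 - q ^ Suc k') * (qbinom q n k' * P k' * P (n - k'))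
         + q ^ Suc k' * (qbinom q n (Suc k') * P (Suc k') * P (n - k'))"
      by (simp add: P_Suc algebra_simps)
    also have "\<dots> = ((1 - q ^ Suc k') + q ^ Suc k' * (1 - q ^ (n - k'))) * P n"
      unfolding IH1 IH2 by (simp add: algebra_simps)
    also have "\<dots> = P (Suc n)"
      unfolding * P_Suc by (simp add: mult.commute)
    finally show ?thesis unfolding P_def .
  qed simp
qed simp

text \<open>\<open>theta c a b\<close> is Ramanujan's \<open>f(c q\<^sup>a, c q\<^sup>b)\<close> for a sign \<open>c\<close>; the exponent of the
  term with index \<open>k\<close> is \<open>a k(k+1)/2 + b k(k-1)/2\<close>.\<close>

definition theta_exp :: "nat \<Rightarrow> nat \<Rightarrow> int \<Rightarrow> nat" where
  "theta_exp a b k = nat ((int a * (k * (k + 1)) + int b * (k * (k - 1))) div 2)"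

lemma int_mult_Suc_nonneg: "0 \<le> k * (k + 1)" "0 \<le> k * (k - 1)" for k :: int
  by (simp_all add: zero_le_mult_iff) presburger+

lemma theta_exp_eq: "2 * int (theta_exp a b k) = int a * (k * (k + 1)) + int b * (k * (k - 1))"
  using int_mult_Suc_nonneg[of k] by (simp add: theta_exp_def)

lemma theta_exp_succ:
  "int (theta_exp a b (k + 1)) = int (theta_exp a b k) + int a + (int a + int b) * k"
proof -
  have "2 * int (theta_exp a b (k + 1)) = 2 * (int (theta_exp a b k) + int a + (int a + int b) * k)"
    unfolding distrib_left theta_exp_eq by (simp add: algebra_simps)
  thus ?thesis by simp
qed

text \<open>The exponent is even at least k^2. The bound makes every coefficient of a theta series a
  finite sum and confines low exponents to central indices.\<close>

lemma theta_exp_ge: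
  assumes "a > 0" "b > 0"
  shows "\<bar>k\<bar> \<le> int (theta_exp a b k)"
proof -
  have "1 * (k * (k + 1)) \<le> int a * (k * (k + 1))" "1 * (k * (k - 1)) \<le> int b * (k * (k - 1))"
    using assms int_mult_Suc_nonneg[of k] by (intro mult_right_mono; simp)+
  hence "k * k \<le> int (theta_exp a b k)"
    using theta_exp_eq[of a b k] by (simp add: algebra_simps)
  moreover have "\<bar>k\<bar> * 1 \<le> \<bar>k\<bar> * \<bar>k\<bar>"
    by (cases "k = 0") (simp, intro mult_left_mono, auto)
  ultimately show ?thesis by simp
qed

lemma finite_theta_exp_fibre:
  assumes "a > 0" "b > 0"
  shows "finite {k. theta_exp a b k = n}"
proof (rule finite_subset)
  show "{k. theta_exp a b k = n} \<subseteq> {- int n..int n}"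
  proof
    fix k assume "k \<in> {k. theta_exp a b k = n}"
    thus "k \<in> {- int n..int n}" using theta_exp_ge[OF assms, of k] by auto
  qed
qed simp

definition theta :: "int \<Rightarrow> nat \<Rightarrow> nat \<Rightarrow> int fps" where
  "theta c a b = Abs_fps (\<lambda>n. \<Sum>k | theta_exp a b k = n. c ^ nat \<bar>k\<bar>)"

text \<open>For a sign \<open>c\<close> the power depends only on the parity of \<open>k\<close>, so
  the absolute value that makes the exponent natural is harmless.\<close>

lemma sign_power_succ:
  fixes c :: int
  assumes "c * c = 1"
  shows "c ^ nat \<bar>k + 1\<bar> = c * c ^ nat \<bar>k\<bar>" "c ^ nat \<bar>k - 1\<bar> = c * c ^ nat \<bar>k\<bar>"
proof -
  have *: "c ^ nat \<bar>k\<bar> = (if even k then 1 else c)" for k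
  proof (cases "even (nat \<bar>k\<bar>)")
    case True
    then obtain m where "nat \<bar>k\<bar> = 2 * m" by (elim evenE)
    moreover have "even k" using True by (simp add: even_nat_iff)
    ultimately show ?thesis using assms by (simp add: power_mult power2_eq_square)
  next
    case False
    then obtain m where "nat \<bar>k\<bar> = 2 * m + 1" by (elim oddE)
    moreover have "odd k" using False by (simp add: even_nat_iff)
    ultimately show ?thesis using assms by (simp add: power_mult power2_eq_square)
  qed
  show "c ^ nat \<bar>k + 1\<bar> = c * c ^ nat \<bar>k\<bar>" "c ^ nat \<bar>k - 1\<bar> = c * c ^ nat \<bar>k\<bar>"
    using assms by (auto simp: *)
qed

text \<open>Each new factor of either product multiplies the right-hand side by the same factor, by
  one of the two q-Pascal rules. The summation index \<open>i\<close> is the theta index shifted by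
  \<open>n\<close>.\<close>

lemma finite_jacobi_triple_product:
  fixes c :: int
  assumes "c * c = 1"
  shows "(\<Prod>j<m. 1 + fps_const c * fps_X ^ (a + (a + b) * j)) * (\<Prod>j<n. 1 + fps_const c * fps_X ^ (b + (a + b) * j))
    = (\<Sum>i\<le>m + n. fps_const (c ^ nat \<bar>int i - int n\<bar>) * fps_X ^ theta_exp a b (int i - int n)
         * qbinom (fps_X ^ (a + b)) (m + n) i)" (is "?A m * ?B n = ?S m n")
proof -
  define Q :: "int fps" where "Q = fps_X ^ (a + b)"
  define t where "t = (\<lambda>k. fps_const (c ^ nat \<bar>k\<bar>) * fps_X ^ theta_exp a b k)"
  define S where "S = (\<lambda>m n. \<Sum>i\<le>m + n. t (int i - int n) * qbinom Q (m + n) i)"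
  \<comment> \<open>Consecutive theta terms have ratio c q^a Q^k; the power \<open>Q ^ l\<close>
    supplied by the Pascal rule turns Q^k into Q^j.\<close>
  have t_up: "t (k + 1) * Q ^ l = fps_const c * fps_X ^ (a + (a + b) * j) * t k" if "int l = int j - k" for k l j
  proof -
    have "(int a + int b) * int l = (int a + int b) * (int j - k)" using that by simp
    hence "int (theta_exp a b (k + 1) + (a + b) * l) = int (theta_exp a b k + (a + (a + b) * j))"
      using theta_exp_succ[of a b k] by (simp add: algebra_simps)
    hence "theta_exp a b (k + 1) + (a + b) * l = theta_exp a b k + (a + (a + b) * j)"
      by (simp only: of_nat_eq_iff)
    hence "fps_X ^ (theta_exp a b (k + 1)) * Q ^ l = fps_X ^ (theta_exp a b k) * fps_X ^ (a + (a + b) * j)"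
      unfolding Q_def by (metis power_add power_mult)
    thus ?thesis
      by (simp add: t_def sign_power_succ[OF assms] mult_ac flip: fps_const_mult)
  qed
  have t_down: "t (k - 1) * Q ^ l = fps_const c * fps_X ^ (b + (a + b) * j) * t k" if "int l = int j + k" for k l j
  proof -
    have "int (theta_exp a b (k - 1) + (a + b) * l) = int (theta_exp a b k + (b + (a + b) * j))"
      using that theta_exp_succ[of a b "k - 1"] by (simp add: algebra_simps)
    hence "theta_exp a b (k - 1) + (a + b) * l = theta_exp a b k + (b + (a + b) * j)"
      by (simp only: of_nat_eq_iff)
    hence "fps_X ^ (theta_exp a b (k - 1)) * Q ^ l = fps_X ^ (theta_exp a b k) * fps_X ^ (b + (a + b) * j)"
      unfolding Q_def by (metis power_add power_mult)
    thus ?thesis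
      by (simp add: t_def sign_power_succ[OF assms] mult_ac flip: fps_const_mult)
  qed
  have S_0: "S 0 0 = 1" by (simp add: S_def t_def theta_exp_def)
  have S_Suc_left: "S (Suc m) n = (1 + fps_const c * fps_X ^ (a + (a + b) * m)) * S m n" for m n
  proof -
    define N where "N = m + n"
    have "S (Suc m) n = (\<Sum>i\<le>Suc N. t (int i - int n) * qbinom Q (Suc N) i)"
      by (simp add: S_def N_def)
    also have "\<dots> = t (- int n) + (\<Sum>i\<le>N. t (int (Suc i) - int n) * qbinom Q (Suc N) (Suc i))"
      by (subst sum.atMost_Suc_shift) simp
    also have "(\<Sum>i\<le>N. t (int (Suc i) - int n) * qbinom Q (Suc N) (Suc i))
       = (\<Sum>i\<le>N. fps_const c * fps_X ^ (a + (a + b) * m) * (t (int i - int n) * qbinom Q N i)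
              + t (int (Suc i) - int n) * qbinom Q N (Suc i))"
    proof (intro sum.cong refl)
      fix i assume i: "i \<in> {..N}"
      have Suc_i: "int (Suc i) - int n = int i - int n + 1" by simp
      have "t (int (Suc i) - int n) * Q ^ (N - i) = fps_const c * fps_X ^ (a + (a + b) * m) * t (int i - int n)"
        unfolding Suc_i by (rule t_up) (use i in \<open>simp add: N_def of_nat_diff\<close>)
      thus "t (int (Suc i) - int n) * qbinom Q (Suc N) (Suc i)
          = fps_const c * fps_X ^ (a + (a + b) * m) * (t (int i - int n) * qbinom Q N i)
              + t (int (Suc i) - int n) * qbinom Q N (Suc i)"
        using i by (simp del: qbinom.simps of_nat_Suc add: qbinom_Suc_Suc' distrib_left mult.assoc[symmetric])
    qed
    also have "t (- int n) + \<dots> = fps_const c * fps_X ^ (a + (a + b) * m) * (\<Sum>i\<le>N. t (int i - int n) * qbinom Q N i)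
         + (t (int 0 - int n) * qbinom Q N 0 + (\<Sum>i\<le>N. t (int (Suc i) - int n) * qbinom Q N (Suc i)))"
      by (simp add: sum.distrib sum_distrib_left)
    also have "t (int 0 - int n) * qbinom Q N 0 + (\<Sum>i\<le>N. t (int (Suc i) - int n) * qbinom Q N (Suc i))
         = (\<Sum>i\<le>Suc N. t (int i - int n) * qbinom Q N i)"
      by (rule sum.atMost_Suc_shift[symmetric])
    also have "\<dots> = (\<Sum>i\<le>N. t (int i - int n) * qbinom Q N i)"
      by (simp add: qbinom_eq_0)
    finally show ?thesis by (simp add: S_def N_def algebra_simps)
  qed
  have S_Suc_right: "S m (Suc n) = (1 + fps_const c * fps_X ^ (b + (a + b) * n)) * S m n" for m n
  proof -
    define N where "N = m + n"
    have "S m (Suc n) = (\<Sum>i\<le>Suc N. t (int i - int (Suc n)) * qbinom Q (Suc N) i)"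
      by (simp add: S_def N_def)
    also have "\<dots> = t (- int (Suc n)) + (\<Sum>i\<le>N. t (int (Suc i) - int (Suc n)) * qbinom Q (Suc N) (Suc i))"
      by (subst sum.atMost_Suc_shift) simp
    also have "(\<Sum>i\<le>N. t (int (Suc i) - int (Suc n)) * qbinom Q (Suc N) (Suc i))
       = (\<Sum>i\<le>N. t (int i - int n) * qbinom Q N i
              + t (int (Suc i) - int (Suc n)) * Q ^ Suc i * qbinom Q N (Suc i))"
      by (simp add: algebra_simps)
    also have "t (- int (Suc n)) + \<dots> = (\<Sum>i\<le>N. t (int i - int n) * qbinom Q N i)
         + (t (int 0 - int (Suc n)) * Q ^ 0 * qbinom Q N 0
            + (\<Sum>i\<le>N. t (int (Suc i) - int (Suc n)) * Q ^ Suc i * qbinom Q N (Suc i)))"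
      by (simp add: sum.distrib)
    also have "t (int 0 - int (Suc n)) * Q ^ 0 * qbinom Q N 0
            + (\<Sum>i\<le>N. t (int (Suc i) - int (Suc n)) * Q ^ Suc i * qbinom Q N (Suc i))
         = (\<Sum>i\<le>Suc N. t (int i - int (Suc n)) * Q ^ i * qbinom Q N i)"
      by (rule sum.atMost_Suc_shift[symmetric])
    also have "\<dots> = (\<Sum>i\<le>N. t (int i - int (Suc n)) * Q ^ i * qbinom Q N i)"
      by (simp add: qbinom_eq_0)
    also have "\<dots> = (\<Sum>i\<le>N. fps_const c * fps_X ^ (b + (a + b) * n) * (t (int i - int n) * qbinom Q N i))"
    proof (intro sum.cong refl)
      fix i
      have "t (int i - int n - 1) * Q ^ i = fps_const c * fps_X ^ (b + (a + b) * n) * t (int i - int n)"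
        by (rule t_down) simp
      moreover have "int i - int (Suc n) = int i - int n - 1" by simp
      ultimately show "t (int i - int (Suc n)) * Q ^ i * qbinom Q N i
          = fps_const c * fps_X ^ (b + (a + b) * n) * (t (int i - int n) * qbinom Q N i)"
        by (simp only: mult.assoc)
    qed
    finally have "S m (Suc n) = S m n + fps_const c * fps_X ^ (b + (a + b) * n) * S m n"
      by (simp add: S_def N_def sum_distrib_left)
    thus ?thesis by (simp add: distrib_right)
  qed
  have "S m n = ?A m * S 0 n" for n
    by (induction m) (simp_all add: S_Suc_left mult_ac)
  moreover have "S 0 n = ?B n"
    by (induction n) (use S_0 in \<open>simp_all add: S_Suc_right mult_ac\<close>)
  ultimately show ?thesis by (simp add: S_def t_def Q_def)
qed

text \<open>Multiplication by the inverse of \<open>u\<close> respects agreement up to index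
  \<open>N\<close>.\<close>

lemma fps_mult_left_cancel_low_coeffs:
  fixes g h u :: "'a::comm_ring_1 fps"
  assumes "fps_nth u 0 = 1" "\<And>i. i \<le> N \<Longrightarrow> fps_nth (u * g) i = fps_nth (u * h) i" "i \<le> N"
  shows "fps_nth g i = fps_nth h i"
proof -
  define v where "v = fps_right_inverse u 1"
  have uv: "v * u = 1"
    using fps_right_inverse[of u 1] assms(1) by (simp add: v_def mult.commute)
  have "fps_nth (v * (u * g)) i = fps_nth (v * (u * h)) i"
    unfolding fps_mult_nth[of v] using assms(2,3) by (intro sum.cong) auto
  thus ?thesis by (simp add: uv flip: mult.assoc)
qed

text \<open>The finite form with \<open>m = n\<close> is multiplied by (Q;Q)_n and \<open>n\<close>
  tends to infinity; the q-binomial times (Q;Q)_n then tends to 1 coefficientwise.\<close>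

lemma jacobi_triple_product:
  assumes "c * c = 1" "a > 0" "b > 0"
  shows "theta c a b = qpoch c a (a + b) * qpoch c b (a + b) * qpoch (-1) (a + b) (a + b)"
proof (rule LIMSEQ_unique)
  define Q :: "int fps" where "Q = fps_X ^ (a + b)"
  define P where "P = (\<lambda>n. \<Prod>i<n. 1 - Q ^ Suc i)"
  define L where "L = (\<lambda>n. (\<Prod>j<n. 1 + fps_const c * fps_X ^ (a + (a + b) * j))
      * (\<Prod>j<n. 1 + fps_const c * fps_X ^ (b + (a + b) * j)) * P n)"
  have P_eq: "P n = (\<Prod>j<n. 1 + fps_const (-1) * fps_X ^ (a + b + (a + b) * j))" for n
    by (simp add: P_def Q_def fps_const_minus_1 flip: power_mult power_add)
  show "L \<longlonglongrightarrow> qpoch c a (a + b) * qpoch c b (a + b) * qpoch (-1) (a + b) (a + b)"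
    unfolding L_def P_eq using assms by (intro tendsto_fps_mult qpoch_tendsto) auto
  have P_0: "fps_nth (P n) 0 = 1" for n
    using assms by (simp add: P_def Q_def fps_prod_nth_0 flip: power_mult power_add)
  have P_stable: "fps_nth (P n) i = fps_nth (P N) i" if "N \<le> n" "i \<le> N" for n N i
    unfolding P_eq
    by (rule fps_prod_nth_stable, rule qpoch_factor_nth) (use that assms in auto)
  \<comment> \<open>The products \<open>P n\<close>, \<open>P k\<close>,
    \<open>P (2 * n - k)\<close> and \<open>P (2 * n)\<close> all agree with \<open>P N\<close> up
    to index \<open>N\<close>, so the quotient formula for the q-binomial reduces to 1
    there.\<close>
  have low: "fps_nth (qbinom Q (2 * n) k * P n) i = fps_nth 1 i"
    if "i \<le> N" "N \<le> k" "N \<le> 2 * n - k" "k \<le> 2 * n" "N \<le> n" for n k i N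
  proof (rule fps_mult_left_cancel_low_coeffs[of "P N" N])
    fix i assume i: "i \<le> N"
    have cong: "fps_nth (g * P N) i = fps_nth (g * P m) i" if "N \<le> m" for g m
      unfolding fps_mult_nth using that i P_stable[of N m] by (intro sum.cong) auto
    have "fps_nth (P N * (qbinom Q (2 * n) k * P n)) i = fps_nth (qbinom Q (2 * n) k * P n * P N) i"
      by (simp add: mult_ac)
    also have "\<dots> = fps_nth (qbinom Q (2 * n) k * P n * P k) i"
      by (rule cong) (use that in auto)
    also have "\<dots> = fps_nth (qbinom Q (2 * n) k * P k * P n) i"
      by (simp add: mult_ac)
    also have "\<dots> = fps_nth (qbinom Q (2 * n) k * P k * P N) i"
      by (rule cong[symmetric]) (use that in auto)
    also have "\<dots> = fps_nth (qbinom Q (2 * n) k * P k * P (2 * n - k)) i"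
      by (rule cong) (use that in auto)
    also have "\<dots> = fps_nth (P (2 * n)) i"
      using qbinom_mult[of k "2 * n" Q] that by (simp add: P_def)
    also have "\<dots> = fps_nth (P N * 1) i"
      using P_stable[of N "2 * n" i] that i by simp
    finally show "fps_nth (P N * (qbinom Q (2 * n) k * P n)) i = fps_nth (P N * 1) i" .
  qed (use that P_0 in auto)
  show "L \<longlonglongrightarrow> theta c a b"
  proof (rule tendsto_fpsI)
    fix N
    show "\<forall>\<^sub>F n in sequentially. fps_nth (L n) N = fps_nth (theta c a b) N"
      \<comment> \<open>Only indices with |i - n| \<le> N contribute to coefficient
        \<open>N\<close>; for these, \<open>n \<ge> 2 * N\<close> gives both
        \<open>N \<le> i\<close> and \<open>N \<le> 2 * n - i\<close>.\<close>
      using eventually_ge_at_top[of "2 * N"]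
    proof eventually_elim
      case (elim n)
      have "fps_nth (L n) N = (\<Sum>i\<le>2 * n. fps_nth (fps_const (c ^ nat \<bar>int i - int n\<bar>)
          * (fps_X ^ theta_exp a b (int i - int n) * (qbinom Q (2 * n) i * P n))) N)"
        unfolding L_def finite_jacobi_triple_product[OF assms(1)]
        by (simp add: sum_distrib_right fps_sum_nth Q_def mult_2 mult.assoc)
      also have "\<dots> = (\<Sum>i\<le>2 * n. if theta_exp a b (int i - int n) = N then c ^ nat \<bar>int i - int n\<bar> else 0)"
      proof (intro sum.cong refl)
        fix i assume i: "i \<in> {..2 * n}"
        let ?e = "theta_exp a b (int i - int n)"
        show "fps_nth (fps_const (c ^ nat \<bar>int i - int n\<bar>) * (fps_X ^ ?e * (qbinom Q (2 * n) i * P n))) N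
            = (if ?e = N then c ^ nat \<bar>int i - int n\<bar> else 0)"
        proof (cases "?e \<le> N")
          case True
          hence "\<bar>int i - int n\<bar> \<le> int N"
            using theta_exp_ge[OF assms(2,3), of "int i - int n"] by linarith
          hence "fps_nth (qbinom Q (2 * n) i * P n) (N - ?e) = fps_nth 1 (N - ?e)"
            using elim i by (intro low[where N = N]) auto
          thus ?thesis using True by (simp add: fps_X_power_mult_nth)
        qed (simp add: fps_X_power_mult_nth)
      qed
      also have "\<dots> = (\<Sum>i | i \<le> 2 * n \<and> theta_exp a b (int i - int n) = N. c ^ nat \<bar>int i - int n\<bar>)"
        by (subst sum.inter_filter[symmetric]) (auto intro!: sum.cong)
      also have "\<dots> = (\<Sum>k | theta_exp a b k = N. c ^ nat \<bar>k\<bar>)"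
      proof (rule sum.reindex_bij_witness[of _ "\<lambda>k. nat (k + int n)" "\<lambda>i. int i - int n"])
        fix k assume "k \<in> {k. theta_exp a b k = N}"
        hence "\<bar>k\<bar> \<le> int n"
          using theta_exp_ge[OF assms(2,3), of k] elim by auto
        thus "int (nat (k + int n)) - int n = k"
          "nat (k + int n) \<in> {i. i \<le> 2 * n \<and> theta_exp a b (int i - int n) = N}"
          using \<open>k \<in> _\<close> by auto
      qed auto
      finally show ?case by (simp add: theta_def)
    qed
  qed
qed

section \<open>3-dissections of theta series\<close>

definition up3 :: "int fps \<Rightarrow> int fps" where
  "up3 g = g oo fps_X ^ 3"

text \<open>For \<open>i = 0\<close> this is the operator \<open>U\<close>.\<close>

definition sect3 :: "nat \<Rightarrow> int fps \<Rightarrow> int fps" where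
  "sect3 i g = Abs_fps (\<lambda>n. fps_nth g (3 * n + i))"

lemma up3_nth: "fps_nth (up3 g) n = (if 3 dvd n then fps_nth g (n div 3) else 0)"
proof -
  have "fps_nth (up3 g) n = (\<Sum>i=0..n. if n = 3 * i then fps_nth g i else 0)"
    unfolding up3_def fps_compose_nth by (intro sum.cong) (auto simp flip: power_mult)
  also have "\<dots> = (\<Sum>i\<in>{i. i \<le> n \<and> n = 3 * i}. fps_nth g i)"
    by (subst sum.inter_filter[symmetric]) (auto intro!: sum.cong)
  also have "{i. i \<le> n \<and> n = 3 * i} = (if 3 dvd n then {n div 3} else {})"
    by auto
  finally show ?thesis by simp
qed

lemma up3_simps [simp]:
  "up3 0 = 0" "up3 1 = 1" "up3 (g + h) = up3 g + up3 h" "up3 (g - h) = up3 g - up3 h" "up3 (- g) = - up3 g"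
  "up3 (g * h) = up3 g * up3 h" "up3 (g ^ n) = up3 g ^ n" "up3 (numeral w) = numeral w"
  "up3 fps_X = fps_X ^ 3" "up3 (fps_const c) = fps_const c"
  by (simp_all add: up3_def fps_compose_add_distrib fps_compose_sub_distrib fps_compose_uminus
        fps_compose_mult_distrib fps_compose_power)

lemma up3_eq_iff [simp]: "up3 g = up3 h \<longleftrightarrow> g = h"
proof
  assume eq: "up3 g = up3 h"
  show "g = h"
  proof (rule fps_ext)
    fix n
    from eq have "fps_nth (up3 g) (3 * n) = fps_nth (up3 h) (3 * n)" by simp
    thus "fps_nth g n = fps_nth h n" by (simp add: up3_nth)
  qed
qed simp

lemma sect3_0_dissection [simp]: "sect3 0 (up3 a + fps_X * up3 b + fps_X\<^sup>2 * up3 c) = a"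
  and sect3_1_dissection [simp]: "sect3 (Suc 0) (up3 a + fps_X * up3 b + fps_X\<^sup>2 * up3 c) = b"
  and sect3_2_dissection [simp]: "sect3 2 (up3 a + fps_X * up3 b + fps_X\<^sup>2 * up3 c) = c"
proof -
  have [simp]: "\<not> 3 dvd Suc (3 * n)" "\<not> 3 dvd Suc (Suc (3 * n))" "\<not> 3 dvd 3 * n - Suc 0 \<or> n = 0"
    "\<not> 3 dvd 3 * n - 2 \<or> n = 0" for n :: nat
    by presburger+
  show "sect3 0 (up3 a + fps_X * up3 b + fps_X\<^sup>2 * up3 c) = a"
    and "sect3 (Suc 0) (up3 a + fps_X * up3 b + fps_X\<^sup>2 * up3 c) = b"
    and "sect3 2 (up3 a + fps_X * up3 b + fps_X\<^sup>2 * up3 c) = c"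
    by (rule fps_ext; auto simp: sect3_def up3_nth fps_X_power_mult_nth; presburger)+
qed

lemma sect3_decomp: "g = up3 (sect3 0 g) + fps_X * up3 (sect3 (Suc 0) g) + fps_X\<^sup>2 * up3 (sect3 2 g)"
proof (rule fps_ext)
  fix n :: nat
  have "n mod 3 = 0 \<or> n mod 3 = 1 \<or> n mod 3 = 2" by presburger
  then obtain m where "n = 3 * m \<or> n = 3 * m + 1 \<or> n = 3 * m + 2"
    by (metis add.right_neutral mult_div_mod_eq)
  moreover have "\<not> 3 dvd Suc (3 * m)" "\<not> 3 dvd Suc (Suc (3 * m))" "\<not> 3 dvd 3 * m - Suc 0 \<or> m = 0"
    "\<not> 3 dvd 3 * m - 2 \<or> m = 0"
    by presburger+
  ultimately show "fps_nth g n = fps_nth (up3 (sect3 0 g) + fps_X * up3 (sect3 (Suc 0) g) + fps_X\<^sup>2 * up3 (sect3 2 g)) n"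
    by (auto simp: sect3_def up3_nth fps_X_power_mult_nth; presburger)
qed

text \<open>Both dissections are multiplied out; an exponent sum of 3 or 4 wraps around and leaves a
  factor \<open>fps_X\<close> after the section.\<close>

lemma sect3_mult:
  "sect3 0 (g * h) = sect3 0 g * sect3 0 h + fps_X * (sect3 (Suc 0) g * sect3 2 h + sect3 2 g * sect3 (Suc 0) h)" (is "_ = ?a")
  "sect3 (Suc 0) (g * h) = sect3 0 g * sect3 (Suc 0) h + sect3 (Suc 0) g * sect3 0 h + fps_X * (sect3 2 g * sect3 2 h)" (is "_ = ?b")
  "sect3 2 (g * h) = sect3 0 g * sect3 2 h + sect3 (Suc 0) g * sect3 (Suc 0) h + sect3 2 g * sect3 0 h" (is "_ = ?c")
proof -
  have "g * h = (up3 (sect3 0 g) + fps_X * up3 (sect3 (Suc 0) g) + fps_X\<^sup>2 * up3 (sect3 2 g))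
      * (up3 (sect3 0 h) + fps_X * up3 (sect3 (Suc 0) h) + fps_X\<^sup>2 * up3 (sect3 2 h))"
    using sect3_decomp[of g] sect3_decomp[of h] by (rule arg_cong2)
  also have "\<dots> = up3 ?a + fps_X * up3 ?b + fps_X\<^sup>2 * up3 ?c"
    by (simp add: algebra_simps power2_eq_square power3_eq_cube)
  finally have gh: "g * h = up3 ?a + fps_X * up3 ?b + fps_X\<^sup>2 * up3 ?c" .
  show "sect3 0 (g * h) = ?a" "sect3 (Suc 0) (g * h) = ?b" "sect3 2 (g * h) = ?c"
    unfolding gh by (simp_all del: up3_simps)
qed

lemma sect3_up3 [simp]: "sect3 0 (up3 g) = g" "sect3 (Suc 0) (up3 g) = 0" "sect3 2 (up3 g) = 0"
  using sect3_0_dissection[of g 0 0] sect3_1_dissection[of g 0 0] sect3_2_dissection[of g 0 0] by simp_all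

lemma sect3_up3_mult: "sect3 0 (up3 g * h) = g * sect3 0 h"
  by (simp add: sect3_mult)

text \<open>A series over all integers with arbitrary signs and exponents, so that passing to a
  residue class of the index stays within the same format.\<close>

definition int_series :: "(int \<Rightarrow> int) \<Rightarrow> (int \<Rightarrow> nat) \<Rightarrow> int fps" where
  "int_series s e = Abs_fps (\<lambda>n. \<Sum>k | e k = n. s k)"

lemma theta_conv_int_series: "theta c a b = int_series (\<lambda>k. c ^ nat \<bar>k\<bar>) (theta_exp a b)"
  by (simp add: theta_def int_series_def)

lemma int_series_reindex:
  assumes "bij h"
  shows "int_series s e = int_series (\<lambda>k. s (h k)) (\<lambda>k. e (h k))"
  unfolding int_series_def
proof (intro arg_cong[of _ _ Abs_fps] ext)
  fix n
  show "(\<Sum>k | e k = n. s k) = (\<Sum>k | e (h k) = n. s (h k))"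
    by (rule sum.reindex_bij_witness[of _ h "inv h"]) (use assms in \<open>auto simp: bij_is_inj bij_is_surj surj_f_inv_f\<close>)
qed

lemma int_series_shift: "fps_X ^ d * int_series s e = int_series s (\<lambda>k. e k + d)"
proof (rule fps_ext)
  fix n
  have "{k. e k + d = n} = (if d \<le> n then {k. e k = n - d} else {})" by auto
  thus "fps_nth (fps_X ^ d * int_series s e) n = fps_nth (int_series s (\<lambda>k. e k + d)) n"
    by (simp add: int_series_def fps_X_power_mult_nth)
qed

lemma int_series_scale: "fps_const c * int_series s e = int_series (\<lambda>k. c * s k) e"
  by (rule fps_ext) (simp add: int_series_def sum_distrib_left)

lemma up3_int_series: "up3 (int_series s e) = int_series s (\<lambda>k. 3 * e k)"
proof (rule fps_ext)
  fix n
  have "{k. 3 * e k = n} = (if 3 dvd n then {k. e k = n div 3} else {})" by auto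
  thus "fps_nth (up3 (int_series s e)) n = fps_nth (int_series s (\<lambda>k. 3 * e k)) n"
    by (simp add: int_series_def up3_nth)
qed

text \<open>Every integer is uniquely \<open>m * k + r\<close> with 0 \<le> r < m. Finite fibres
  exclude the default value 0 of infinite sums.\<close>

lemma int_series_split:
  assumes fin: "\<And>n. finite {k. e k = n}" and "m > 0"
  shows "int_series s e = (\<Sum>r<m. int_series (\<lambda>k. s (int m * k + int r)) (\<lambda>k. e (int m * k + int r)))"
proof (rule fps_ext)
  fix n
  have fin': "finite {k. e (int m * k + int r) = n}" for r
    using finite_vimageI[OF fin, of "\<lambda>k. int m * k + int r"] \<open>m > 0\<close>
    by (simp add: vimage_def inj_def)
  have "(\<Sum>r<m. \<Sum>k | e (int m * k + int r) = n. s (int m * k + int r))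
      = (\<Sum>(r, k)\<in>Sigma {..<m} (\<lambda>r. {k. e (int m * k + int r) = n}). s (int m * k + int r))"
    using fin' by (intro sum.Sigma) auto
  also have "\<dots> = (\<Sum>k | e k = n. s k)"
    by (rule sum.reindex_bij_witness[of _ "\<lambda>k. (nat (k mod int m), k div int m)" "\<lambda>(r, k). int m * k + int r"])
       (use \<open>m > 0\<close> in \<open>auto simp: nat_less_iff\<close>)
  finally show "fps_nth (int_series s e) n
      = fps_nth (\<Sum>r<m. int_series (\<lambda>k. s (int m * k + int r)) (\<lambda>k. e (int m * k + int r))) n"
    by (simp add: int_series_def fps_sum_nth)
qed

lemma minus_one_power_abs: "(-1 :: int) ^ nat \<bar>k\<bar> = (if even k then 1 else -1)"
  by (simp add: minus_one_power_iff even_nat_iff)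

lemma bij_int_reflect: "bij (\<lambda>k::int. c - k)"
  by (rule bij_betw_byWitness[of _ "\<lambda>k. c - k"]) auto

text \<open>In Ramanujan's notation these are \<open>\<phi>(-q)\<close>, \<open>\<psi>(q)\<close>, \<open>f(-q,-q\<^sup>5)\<close> and
  \<open>f(q,q\<^sup>2)\<close>.\<close>

abbreviation "\<phi> \<equiv> theta (-1) 1 1"
abbreviation "\<psi> \<equiv> theta 1 1 3"
abbreviation "\<Omega> \<equiv> theta (-1) 5 1"
abbreviation "\<Upsilon> \<equiv> theta 1 1 2"

text \<open>The exponents are the squares; those of indices not divisible by 3 are 1 modulo 3, and k
  \<mapsto> -k exchanges the two classes, whence the coefficient 2.\<close>

lemma phi_dissection: "\<phi> = up3 (up3 \<phi>) - 2 * fps_X * up3 \<Omega>"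
proof -
  define s :: "int \<Rightarrow> int" where "s = (\<lambda>k. (-1) ^ nat \<bar>k\<bar>)"
  define e where "e = theta_exp 1 1"
  have e: "int (e k) = k * k" for k
    using theta_exp_eq[of 1 1 k] by (simp add: e_def algebra_simps)
  have e': "2 * int (theta_exp 5 1 k) = 6 * k * k + 4 * k" for k
    using theta_exp_eq[of 5 1 k] by (simp add: algebra_simps)
  have "\<phi> = (\<Sum>r<3. int_series (\<lambda>k. s (int 3 * k + int r)) (\<lambda>k. e (int 3 * k + int r)))"
    unfolding theta_conv_int_series s_def e_def
    by (rule int_series_split) (use finite_theta_exp_fibre[of 1 1] in auto)
  also have "\<dots> = int_series (\<lambda>k. s (3 * k)) (\<lambda>k. e (3 * k)) + int_series (\<lambda>k. s (3 * k + 1)) (\<lambda>k. e (3 * k + 1))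
      + int_series (\<lambda>k. s (3 * k + 2)) (\<lambda>k. e (3 * k + 2))"
    by (simp add: eval_nat_numeral lessThan_Suc add_ac)
  \<comment> \<open>The reflection turns 3k + 2 into -(3k + 1), which has the same square and the
    same parity as 3k + 1.\<close>
  also have "int_series (\<lambda>k. s (3 * k + 2)) (\<lambda>k. e (3 * k + 2))
      = int_series (\<lambda>k. s (3 * (-1 - k) + 2)) (\<lambda>k. e (3 * (-1 - k) + 2))"
    by (rule int_series_reindex[OF bij_int_reflect])
  also have "\<dots> = int_series (\<lambda>k. s (3 * k + 1)) (\<lambda>k. e (3 * k + 1))"
  proof -
    have "int (e (3 * (-1 - k) + 2)) = int (e (3 * k + 1))" for k
      unfolding e by (simp add: algebra_simps)
    moreover have "s (3 * (-1 - k) + 2) = s (3 * k + 1)" for k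
      unfolding s_def minus_one_power_abs by simp
    ultimately show ?thesis by simp
  qed
  \<comment> \<open>Here (3k + 1)^2 = 3 (3k^2 + 2k) + 1, where 3k^2 + 2k is the exponent of
    \<open>\<Omega>\<close>; the shift by 1 flips the sign.\<close>
  also have "int_series (\<lambda>k. s (3 * k + 1)) (\<lambda>k. e (3 * k + 1)) = - (fps_X * up3 \<Omega>)"
  proof -
    have "fps_const (-1) * (fps_X ^ 1 * up3 \<Omega>) = int_series (\<lambda>k. -1 * s k) (\<lambda>k. 3 * theta_exp 5 1 k + 1)"
      unfolding theta_conv_int_series up3_int_series int_series_shift int_series_scale s_def ..
    moreover have "int (3 * theta_exp 5 1 k + 1) = int (e (3 * k + 1))" for k
      using e'[of k] unfolding e by (simp add: algebra_simps)
    hence "3 * theta_exp 5 1 k + 1 = e (3 * k + 1)" for k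
      by (simp only: of_nat_eq_iff)
    moreover have "-1 * s k = s (3 * k + 1)" for k
      unfolding s_def minus_one_power_abs by simp
    ultimately show ?thesis by (simp add: fps_const_minus_1)
  qed
  also have "int_series (\<lambda>k. s (3 * k)) (\<lambda>k. e (3 * k)) = up3 (up3 \<phi>)"
  proof -
    have "up3 (up3 \<phi>) = int_series s (\<lambda>k. 3 * (3 * e k))"
      unfolding theta_conv_int_series up3_int_series s_def e_def ..
    moreover have "int (3 * (3 * e k)) = int (e (3 * k))" for k
      unfolding e of_nat_mult by (simp add: algebra_simps)
    hence "3 * (3 * e k) = e (3 * k)" for k
      by (simp only: of_nat_eq_iff)
    moreover have "s k = s (3 * k)" for k
      unfolding s_def minus_one_power_abs by simp
    ultimately show ?thesis by simp
  qed
  finally show ?thesis by (simp add: algebra_simps)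
qed

text \<open>The exponent 2k^2 - k is divisible by 3 for k = 0 and 2 modulo 3, and is 1 modulo 3
  otherwise.\<close>

lemma psi_dissection: "\<psi> = up3 \<Upsilon> + fps_X * up3 (up3 \<psi>)"
proof -
  define I where "I = int_series (\<lambda>_. 1)"
  define e where "e = theta_exp 1 3"
  have e: "int (e k) = 2 * k * k - k" for k
    using theta_exp_eq[of 1 3 k] by (simp add: e_def algebra_simps)
  have e': "2 * int (theta_exp 1 2 k) = 3 * k * k - k" for k
    using theta_exp_eq[of 1 2 k] by (simp add: algebra_simps)
  have psi: "\<psi> = I e" by (simp add: theta_conv_int_series I_def e_def)
  have "\<psi> = (\<Sum>r<3. I (\<lambda>k. e (int 3 * k + int r)))"
    unfolding psi I_def unfolding e_def
    by (rule int_series_split) (use finite_theta_exp_fibre[of 1 3] in auto)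
  also have "\<dots> = I (\<lambda>k. e (3 * k)) + I (\<lambda>k. e (3 * k + 1)) + I (\<lambda>k. e (3 * k + 2))"
    by (simp add: eval_nat_numeral lessThan_Suc add_ac)
  also have "I (\<lambda>k. e (3 * k + 2)) = I (\<lambda>k. e (3 * (-1 - k) + 2))"
    unfolding I_def by (rule int_series_reindex[OF bij_int_reflect])
  also have "I (\<lambda>k. e (3 * k + 1)) = I (\<lambda>k. e (3 * (0 - k) + 1))"
    unfolding I_def by (rule int_series_reindex[OF bij_int_reflect])
  also have "\<dots> = fps_X * up3 (up3 \<psi>)"
  proof -
    have "fps_X ^ 1 * up3 (up3 \<psi>) = I (\<lambda>k. 3 * (3 * e k) + 1)"
      unfolding psi I_def up3_int_series int_series_shift ..
    moreover have "int (3 * (3 * e k) + 1) = int (e (3 * (0 - k) + 1))" for k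
      unfolding e of_nat_mult of_nat_add by (simp add: algebra_simps)
    hence "3 * (3 * e k) + 1 = e (3 * (0 - k) + 1)" for k
      by (simp only: of_nat_eq_iff)
    ultimately show ?thesis by simp
  qed
  \<comment> \<open>The two remaining classes are the even-index and odd-index halves of
    \<open>\<Upsilon>\<close>, so that series is split modulo 2 to match them.\<close>
  also have "I (\<lambda>k. e (3 * k)) + fps_X * up3 (up3 \<psi>) + I (\<lambda>k. e (3 * (-1 - k) + 2)) = up3 \<Upsilon> + fps_X * up3 (up3 \<psi>)"
  proof -
    have "\<Upsilon> = I (theta_exp 1 2)" by (simp add: theta_conv_int_series I_def)
    also have "\<dots> = (\<Sum>r<2. I (\<lambda>k. theta_exp 1 2 (int 2 * k + int r)))"
      unfolding I_def by (rule int_series_split) (use finite_theta_exp_fibre[of 1 2] in auto)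
    also have "\<dots> = I (\<lambda>k. theta_exp 1 2 (2 * k)) + I (\<lambda>k. theta_exp 1 2 (2 * k + 1))"
      by (simp add: eval_nat_numeral lessThan_Suc add_ac)
    finally have "up3 \<Upsilon> = I (\<lambda>k. 3 * theta_exp 1 2 (2 * k)) + I (\<lambda>k. 3 * theta_exp 1 2 (2 * k + 1))"
      by (simp add: I_def up3_int_series)
    moreover have "int (3 * theta_exp 1 2 (2 * k)) = int (e (3 * k))" for k
      using e'[of "2 * k"] unfolding e of_nat_mult of_nat_add by (simp add: algebra_simps)
    hence "3 * theta_exp 1 2 (2 * k) = e (3 * k)" for k
      by (simp only: of_nat_eq_iff)
    moreover have "int (3 * theta_exp 1 2 (2 * k + 1)) = int (e (3 * (-1 - k) + 2))" for k
      using e'[of "2 * k + 1"] unfolding e of_nat_mult of_nat_add by (simp add: algebra_simps)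
    hence "3 * theta_exp 1 2 (2 * k + 1) = e (3 * (-1 - k) + 2)" for k
      by (simp only: of_nat_eq_iff)
    ultimately show ?thesis by simp
  qed
  finally show ?thesis .
qed

section \<open>The cubic norm and the dissection of \<open>f\<^sub>1 f\<^sub>2\<close>\<close>

lemma tendsto_fps_componentwise:
  fixes a b :: "'a::ring_1 fps"
  assumes "(u \<longlongrightarrow> a) F" "(v \<longlongrightarrow> b) F"
  shows tendsto_fps_add: "((\<lambda>x. u x + v x) \<longlongrightarrow> a + b) F"
    and tendsto_fps_diff: "((\<lambda>x. u x - v x) \<longlongrightarrow> a - b) F"
proof -
  show "((\<lambda>x. u x + v x) \<longlongrightarrow> a + b) F" "((\<lambda>x. u x - v x) \<longlongrightarrow> a - b) F"
    unfolding tendsto_fps_iff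
  proof (safe)
    fix n
    have uv: "\<forall>\<^sub>F x in F. fps_nth (u x) n = fps_nth a n" "\<forall>\<^sub>F x in F. fps_nth (v x) n = fps_nth b n"
      using assms unfolding tendsto_fps_iff by blast+
    show "\<forall>\<^sub>F x in F. fps_nth (u x + v x) n = fps_nth (a + b) n"
      using uv by eventually_elim simp
    show "\<forall>\<^sub>F x in F. fps_nth (u x - v x) n = fps_nth (a - b) n"
      using uv by eventually_elim simp
  qed
qed

lemma tendsto_sect3:
  assumes "(u \<longlongrightarrow> a) F"
  shows "((\<lambda>x. sect3 i (u x)) \<longlongrightarrow> sect3 i a) F"
  using assms by (simp add: tendsto_fps_iff sect3_def)

lemma tendsto_up3:
  assumes "(u \<longlongrightarrow> a) F"
  shows "((\<lambda>x. up3 (u x)) \<longlongrightarrow> up3 a) F"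
  using assms by (simp add: tendsto_fps_iff up3_nth)

lemma up3_prod: "up3 (\<Prod>i\<in>I. u i) = (\<Prod>i\<in>I. up3 (u i))"
  by (simp add: up3_def fps_compose_prod_distrib)

lemma up3_qpoch:
  assumes "r > 0" "s > 0"
  shows "up3 (qpoch c r s) = qpoch c (3 * r) (3 * s)"
proof (rule LIMSEQ_unique)
  show "(\<lambda>n. up3 (\<Prod>j<n. 1 + fps_const c * fps_X ^ (r + s * j))) \<longlonglongrightarrow> up3 (qpoch c r s)"
    by (intro tendsto_up3 qpoch_tendsto assms)
  have "up3 (\<Prod>j<n. 1 + fps_const c * fps_X ^ (r + s * j)) = (\<Prod>j<n. 1 + fps_const c * fps_X ^ (3 * r + 3 * s * j))" for n
    by (simp add: up3_prod algebra_simps flip: power_mult)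
  thus "(\<lambda>n. up3 (\<Prod>j<n. 1 + fps_const c * fps_X ^ (r + s * j))) \<longlonglongrightarrow> qpoch c (3 * r) (3 * s)"
    using qpoch_tendsto[of "3 * r" "3 * s" c] assms by simp
qed

lemma up3_f: "k > 0 \<Longrightarrow> up3 (f k) = f (3 * k)"
  by (simp add: f_eq_qpoch up3_qpoch)

text \<open>The norm of \<open>g\<close> over the subring of series in \<open>q\<^sup>3\<close>, that is the product of \<open>g(\<omega>q)\<close> over the
  cube roots of unity \<open>\<omega>\<close>, with \<open>q\<^sup>3\<close> replaced by \<open>q\<close>.\<close>

definition norm3 :: "int fps \<Rightarrow> int fps" where
  "norm3 g = sect3 0 g ^ 3 + fps_X * sect3 1 g ^ 3 + fps_X\<^sup>2 * sect3 2 g ^ 3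
     - 3 * fps_X * (sect3 0 g * sect3 1 g * sect3 2 g)"

text \<open>As for any norm; here it is a polynomial identity in the six sections.\<close>

lemma norm3_mult: "norm3 (g * h) = norm3 g * norm3 h"
  unfolding norm3_def One_nat_def sect3_mult by algebra

lemma norm3_dissection:
  "norm3 (up3 a + fps_X * up3 b + fps_X\<^sup>2 * up3 c)
     = a ^ 3 + fps_X * b ^ 3 + fps_X\<^sup>2 * c ^ 3 - 3 * fps_X * (a * b * c)"
  by (simp add: norm3_def del: up3_simps)

lemma norm3_up3: "norm3 (up3 g) = g ^ 3"
  by (simp add: norm3_def)

lemma norm3_1: "norm3 1 = 1"
  using norm3_up3[of 1] by simp

lemma norm3_prod: "norm3 (\<Prod>i\<in>I. u i) = (\<Prod>i\<in>I. norm3 (u i))"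
  by (induction I rule: infinite_finite_induct) (auto simp: norm3_1 norm3_mult)

lemma tendsto_norm3:
  assumes "(u \<longlongrightarrow> a) F"
  shows "((\<lambda>x. norm3 (u x)) \<longlongrightarrow> norm3 a) F"
  unfolding norm3_def power3_eq_cube
  by (intro tendsto_fps_add tendsto_fps_diff tendsto_fps_mult tendsto_const tendsto_sect3 assms)

text \<open>The conjugates multiply to 1 - q^(3m), and replacing q^3 by q restores 1 - q^m.\<close>

lemma norm3_one_minus_X_power:
  assumes "\<not> 3 dvd m"
  shows "norm3 (1 - fps_X ^ m) = 1 - fps_X ^ m"
proof -
  define k where "k = m div 3"
  have "m mod 3 = 1 \<or> m mod 3 = 2" using assms by presburger
  thus ?thesis
  proof
    assume "m mod 3 = 1"
    hence m: "m = Suc (3 * k)" unfolding k_def by presburger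
    have "1 - fps_X ^ m = up3 1 + fps_X * up3 (- (fps_X ^ k)) + fps_X\<^sup>2 * up3 0"
      by (simp add: m flip: power_mult)
    also have "norm3 \<dots> = 1 - fps_X ^ m"
      unfolding norm3_dissection by (simp add: m mult.commute flip: power_mult)
    finally show ?thesis .
  next
    assume "m mod 3 = 2"
    hence m: "m = 2 + 3 * k" unfolding k_def by presburger
    have "1 - fps_X ^ m = up3 1 + fps_X * up3 0 + fps_X\<^sup>2 * up3 (- (fps_X ^ k))"
      by (simp add: m power_add power2_eq_square flip: power_mult)
    also have "norm3 \<dots> = 1 - fps_X ^ m"
      unfolding norm3_dissection by (simp add: m mult.commute power_add power2_eq_square flip: power_mult)
    finally show ?thesis .
  qed
qed

lemma prod_lessThan_3:
  fixes g :: "nat \<Rightarrow> 'a::comm_monoid_mult"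
  shows "(\<Prod>i<3. g i) = g 0 * g 1 * g 2"
  by (simp add: eval_nat_numeral lessThan_Suc mult_ac)

text \<open>The norm fixes the factors whose exponent is prime to 3, which form f_k / f_(3k), and
  turns the remaining ones into the cubes of all factors of \<open>f k\<close>.\<close>

lemma norm3_f:
  assumes "\<not> 3 dvd k"
  shows "norm3 (f k) * f (3 * k) = f k ^ 4"
proof -
  have "k > 0" using assms by (intro Nat.gr0I) auto
  define u where "u = (\<lambda>r s j. 1 + fps_const (-1 :: int) * fps_X ^ (r + s * j))"
  have u: "u r s j = 1 - fps_X ^ (r + s * j)" for r s j
    by (simp add: u_def fps_const_minus_1)
  have "norm3 (f k) = qpoch (-1) k (3 * k) * qpoch (-1) (2 * k) (3 * k) * f k ^ 3"
  proof (rule LIMSEQ_unique)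
    have "filterlim (\<lambda>n::nat. 3 * n) at_top sequentially"
      by (intro filterlim_subseq strict_monoI) auto
    hence "(\<lambda>n. \<Prod>j<3 * n. u k k j) \<longlonglongrightarrow> f k"
      unfolding u_def f_eq_qpoch by (rule filterlim_compose[OF qpoch_tendsto[OF \<open>k > 0\<close> \<open>k > 0\<close>]])
    thus "(\<lambda>n. norm3 (\<Prod>j<3 * n. u k k j)) \<longlonglongrightarrow> norm3 (f k)"
      by (rule tendsto_norm3)
    \<comment> \<open>Factor \<open>j\<close> has exponent k (j + 1), so the indices divisible by 3
      or 1 modulo 3 have exponents prime to 3.\<close>
    have ind: "\<not> 3 dvd k + k * (3 * j)" "\<not> 3 dvd k + k * (Suc 0 + 3 * j)" for j
    proof -
      have "\<not> 3 dvd 3 * (k * j) + k" "\<not> 3 dvd 3 * (k * j) + 2 * k"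
        using assms by presburger+
      thus "\<not> 3 dvd k + k * (3 * j)" "\<not> 3 dvd k + k * (Suc 0 + 3 * j)"
        by (simp_all add: algebra_simps)
    qed
    have "norm3 (\<Prod>j<3 * n. u k k j) = (\<Prod>j<n. u k (3 * k) j) * (\<Prod>j<n. u (2 * k) (3 * k) j) * (\<Prod>j<n. u k k j) ^ 3" for n
    proof -
      have "norm3 (u k k (3 * j)) = u k (3 * k) j" for j
        using norm3_one_minus_X_power[OF ind(1)[of j]] by (simp add: u mult_ac)
      moreover have "norm3 (u k k (Suc (3 * j))) = u (2 * k) (3 * k) j" for j
        using norm3_one_minus_X_power[OF ind(2)[of j]] by (simp add: u algebra_simps)
      moreover have "norm3 (u k k (Suc (Suc (3 * j)))) = u k k j ^ 3" for j
      proof -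
        have "u k k (Suc (Suc (3 * j))) = up3 (u k k j)"
          by (simp add: u algebra_simps flip: power_mult)
        thus ?thesis by (simp add: norm3_up3)
      qed
      moreover have "norm3 (\<Prod>j<3 * n. u k k j) = (\<Prod>j<n. norm3 (u k k (3 * j)))
          * (\<Prod>j<n. norm3 (u k k (Suc (3 * j)))) * (\<Prod>j<n. norm3 (u k k (Suc (Suc (3 * j)))))"
        by (simp add: norm3_prod norm3_mult prod_lessThan_mult prod_lessThan_3)
      ultimately show ?thesis by (simp add: prod_power_distrib)
    qed
    moreover have "(\<lambda>n. (\<Prod>j<n. u k (3 * k) j) * (\<Prod>j<n. u (2 * k) (3 * k) j) * (\<Prod>j<n. u k k j) ^ 3) \<longlonglongrightarrow>
        qpoch (-1) k (3 * k) * qpoch (-1) (2 * k) (3 * k) * f k ^ 3"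
      unfolding u_def f_eq_qpoch power3_eq_cube
      using \<open>k > 0\<close> by (intro tendsto_fps_mult qpoch_tendsto) auto
    ultimately show "(\<lambda>n. norm3 (\<Prod>j<3 * n. u k k j)) \<longlonglongrightarrow> qpoch (-1) k (3 * k) * qpoch (-1) (2 * k) (3 * k) * f k ^ 3"
      by simp
  qed
  moreover have "f k = qpoch (-1) k (3 * k) * qpoch (-1) (2 * k) (3 * k) * f (3 * k)"
    using qpoch_split[of k k 3 "-1"] \<open>k > 0\<close> by (simp add: f_eq_qpoch eval_nat_numeral lessThan_Suc mult_ac)
  ultimately show ?thesis by algebra
qed

section \<open>Infinite products for the four theta series\<close>

lemmas numeral_unfold = eval_nat_numeral lessThan_Suc

lemma phi_product: "\<phi> * f 2 = f 1 ^ 2"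
proof -
  have "\<phi> = qpoch (-1) 1 2 * qpoch (-1) 1 2 * qpoch (-1) 2 2"
    using jacobi_triple_product[of "-1" 1 1] by (simp add: numeral_2_eq_2)
  moreover have "f 1 = qpoch (-1) 1 2 * qpoch (-1) 2 2"
    using qpoch_split[of 1 1 2 "-1"] by (simp add: f_eq_qpoch numeral_2_eq_2 mult_ac)
  ultimately show ?thesis by (simp add: f_eq_qpoch power2_eq_square mult_ac)
qed

text \<open>Everything is split modulo 4; the plus-sign factors are removed by (1 + x)(1 - x) = 1 -
  x^2, which produces the classes 2 and 6 modulo 8.\<close>

lemma psi_product: "\<psi> * f 1 = f 2 ^ 2"
proof -
  let ?p = "\<lambda>r. qpoch (-1) r 4" and ?q = "\<lambda>r. qpoch 1 r 4"
  have "\<psi> = ?q 1 * ?q 3 * ?p 4"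
    using jacobi_triple_product[of 1 1 3] by simp
  moreover have "f 1 = ?p 1 * ?p 2 * ?p 3 * ?p 4"
    using qpoch_split[of 1 1 4 "-1"] by (simp add: f_eq_qpoch numeral_unfold mult_ac)
  moreover have "f 2 = ?p 2 * ?p 4" "?p 2 = qpoch (-1) 2 8 * qpoch (-1) 6 8"
    using qpoch_split[of 2 2 2 "-1"] qpoch_split[of 2 4 2 "-1"] by (simp_all add: f_eq_qpoch numeral_unfold mult_ac)
  moreover have "?q 1 * ?p 1 = qpoch (-1) 2 8" "?q 3 * ?p 3 = qpoch (-1) 6 8"
    using qpoch_plus_minus[of 1 4] qpoch_plus_minus[of 3 4] by simp_all
  ultimately show ?thesis by algebra
qed

lemma Omega_product: "\<Omega> * (f 2 * f 3) = f 1 * f 6 ^ 2"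
proof -
  let ?p = "\<lambda>r. qpoch (-1) r 6"
  have "\<Omega> = ?p 5 * ?p 1 * ?p 6"
    using jacobi_triple_product[of "-1" 5 1] by simp
  moreover have "f 1 = ?p 1 * ?p 2 * ?p 3 * ?p 4 * ?p 5 * ?p 6" "f 2 = ?p 2 * ?p 4 * ?p 6" "f 3 = ?p 3 * ?p 6" "f 6 = ?p 6"
    using qpoch_split[of 1 1 6 "-1"] qpoch_split[of 2 2 3 "-1"] qpoch_split[of 3 3 2 "-1"]
    by (simp_all add: f_eq_qpoch numeral_unfold mult_ac)
  ultimately show ?thesis by algebra
qed

lemma Upsilon_product: "\<Upsilon> * (f 1 * f 6) = f 2 * f 3 ^ 2"
proof -
  let ?p = "\<lambda>r. qpoch (-1) r 3" and ?q = "\<lambda>r. qpoch 1 r 3" and ?p6 = "\<lambda>r. qpoch (-1) r 6"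
  have "\<Upsilon> = ?q 1 * ?q 2 * ?p 3"
    using jacobi_triple_product[of 1 1 2] by (simp add: numeral_3_eq_3)
  moreover have "f 1 = ?p 1 * ?p 2 * ?p 3" "f 2 = ?p6 2 * ?p6 4 * ?p6 6" "f 3 = ?p 3" "f 6 = ?p6 6"
    using qpoch_split[of 1 1 3 "-1"] qpoch_split[of 2 2 3 "-1"]
    by (simp_all add: f_eq_qpoch numeral_unfold mult_ac)
  moreover have "?q 1 * ?p 1 = ?p6 2" "?q 2 * ?p 2 = ?p6 4"
    using qpoch_plus_minus[of 1 3] qpoch_plus_minus[of 2 3] by simp_all
  ultimately show ?thesis by algebra
qed

lemma phi_mult_psi: "\<phi> * \<psi> = f 1 * f 2"
proof -
  have "(\<phi> * \<psi>) * (f 1 * f 2) = (f 1 * f 2) * (f 1 * f 2)"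
    using phi_product psi_product by algebra
  thus ?thesis using f_neq_0[of 1] f_neq_0[of 2] by simp
qed

lemma Omega_mult_Upsilon: "\<Omega> * \<Upsilon> = f 3 * f 6"
proof -
  have "(\<Omega> * \<Upsilon>) * (f 1 * f 2 * f 3 * f 6) = (f 3 * f 6) * (f 1 * f 2 * f 3 * f 6)"
    using Omega_product Upsilon_product by algebra
  thus ?thesis using f_neq_0[of 1] f_neq_0[of 2] f_neq_0[of 3] f_neq_0[of 6] by simp
qed

lemma f1_mult_f2_dissection:
  obtains a c where
    "f 1 * f 2 = up3 a - fps_X * (f 9 * f 18) - 2 * fps_X\<^sup>2 * up3 c" "a * c = (f 3 * f 6)\<^sup>2"
proof
  have 3: "up3 \<phi> * up3 \<psi> = f 3 * f 6"
    using arg_cong[OF phi_mult_psi, of up3] by (simp add: up3_f)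
  have 9: "up3 (up3 \<phi>) * up3 (up3 \<psi>) = f 9 * f 18"
    using arg_cong[OF 3, of up3] by (simp add: up3_f)
  have \<Omega>\<Upsilon>: "up3 \<Omega> * up3 \<Upsilon> = f 9 * f 18"
    using arg_cong[OF Omega_mult_Upsilon, of up3] by (simp add: up3_f)
  \<comment> \<open>The middle coefficient is \<open>f 9 * f 18\<close> from the two outer theta
    series minus twice the same product from \<open>\<Omega>\<close> and
    \<open>\<Upsilon>\<close>.\<close>
  show "f 1 * f 2 = up3 (up3 \<phi> * \<Upsilon>) - fps_X * (f 9 * f 18) - 2 * fps_X\<^sup>2 * up3 (\<Omega> * up3 \<psi>)"
    using phi_dissection psi_dissection 9 \<Omega>\<Upsilon> phi_mult_psi by (simp del: up3_eq_iff) algebra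
  show "up3 \<phi> * \<Upsilon> * (\<Omega> * up3 \<psi>) = (f 3 * f 6)\<^sup>2"
    using 3 Omega_mult_Upsilon by algebra
qed

section \<open>Polynomials without constant term and iterated 3-sections\<close>

text \<open>The part of \<open>t \<int>[t]\<close> with natural coefficients, to which every section below belongs.\<close>

inductive pos_poly :: "'a::comm_semiring_1 \<Rightarrow> 'a \<Rightarrow> bool" for t where
  power: "pos_poly t (t ^ Suc n)"
| add: "pos_poly t g \<Longrightarrow> pos_poly t h \<Longrightarrow> pos_poly t (g + h)"

lemma pos_poly_self: "pos_poly t t"
  using pos_poly.power[of t 0] by simp

lemma pos_poly_mult:
  assumes "pos_poly t g" "pos_poly t h"
  shows "pos_poly t (g * h)"
  using assms(1)
proof induction
  case (power n)
  show ?case using assms(2)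
  proof induction
    case (power m)
    show ?case using pos_poly.power[of t "n + Suc m"] by (simp add: power_add mult_ac)
  qed (auto simp: distrib_left intro: pos_poly.add)
qed (auto simp: distrib_right intro: pos_poly.add)

lemma pos_poly_numeral: "pos_poly t g \<Longrightarrow> pos_poly t (numeral w * g)"
proof (induction w)
  case (Bit0 w)
  show ?case unfolding numeral_Bit0 distrib_right by (intro pos_poly.add Bit0)
next
  case (Bit1 w)
  show ?case unfolding numeral_Bit1 distrib_right mult_1 by (intro pos_poly.add Bit1)
qed simp

lemma pos_poly_power: "pos_poly t g \<Longrightarrow> pos_poly t (g ^ Suc n)"
  by (induction n) (auto intro: pos_poly_mult)

lemma pos_poly_numeral_power: "pos_poly t g \<Longrightarrow> pos_poly t (numeral w ^ n * g)"
  by (induction n) (auto intro: pos_poly_numeral simp: mult.assoc)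

text \<open>Without constant term every monomial contains the multiplier; with \<open>9 * T\<close>
  as the variable this supplies a last factor 9.\<close>

lemma pos_poly_numeral_mult:
  assumes "pos_poly (numeral w * t) g"
  obtains r where "g = numeral w * r"
proof -
  have "numeral w dvd g"
    using assms by induction auto
  thus ?thesis using that by (elim dvdE)
qed

lemma sect3_add: "sect3 i (g + h) = sect3 i g + sect3 i h"
  by (simp add: sect3_def fps_eq_iff)

lemma sect3_0_numeral: "sect3 0 (numeral w * g) = numeral w * sect3 0 g"
  using sect3_up3_mult[of "numeral w" g] by simp

lemma sect3_0_X:
  "sect3 0 (fps_X * g) = fps_X * sect3 2 g" "sect3 0 (fps_X\<^sup>2 * g) = fps_X * sect3 (Suc 0) g"
proof -
  have "sect3 0 fps_X = 0" "sect3 (Suc 0) fps_X = 1" "sect3 2 fps_X = 0"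
    using sect3_0_dissection[of 0 1 0] sect3_1_dissection[of 0 1 0] sect3_2_dissection[of 0 1 0] by simp_all
  thus "sect3 0 (fps_X * g) = fps_X * sect3 2 g" by (simp add: sect3_mult)
  have "sect3 0 (fps_X\<^sup>2) = 0" "sect3 (Suc 0) (fps_X\<^sup>2) = 0" "sect3 2 (fps_X\<^sup>2) = 1"
    using sect3_0_dissection[of 0 0 1] sect3_1_dissection[of 0 0 1] sect3_2_dissection[of 0 0 1] by simp_all
  thus "sect3 0 (fps_X\<^sup>2 * g) = fps_X * sect3 (Suc 0) g" by (simp add: sect3_mult)
qed

text \<open>Applied to \<open>Y = 3Z\<close> and \<open>t = 9T\<close>: after this rescaling the 3-section of every positive power of \<open>Y\<close>
  is an integral polynomial in \<open>t\<close>, and the factor 3 in \<open>t_eq\<close> is what each further section gains.\<close>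

locale cubic_tower =
  fixes Y t :: "int fps"
  assumes cubic: "Y ^ 3 = 3 * up3 t * (1 + Y + Y\<^sup>2)"
    and t_eq: "t = 3 * (Y + Y\<^sup>2 + Y ^ 3)"
    and sect_Y: "sect3 0 Y = t"
    and sect_Y2: "sect3 0 (Y\<^sup>2) = 2 * t + 3 * t\<^sup>2"
begin

text \<open>The cubic equation times \<open>Y ^ n\<close>, with the factor in q^3 taken out of the
  section.\<close>

lemma sect3_Y_power_rec:
  "sect3 0 (Y ^ (3 + n)) = 3 * t * (sect3 0 (Y ^ n) + sect3 0 (Y ^ Suc n) + sect3 0 (Y ^ Suc (Suc n)))"
proof -
  have "Y ^ (3 + n) = up3 (3 * t) * (Y ^ n + Y ^ Suc n + Y ^ Suc (Suc n))"
    unfolding power_add cubic by (simp add: algebra_simps power2_eq_square)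
  thus ?thesis by (simp only: sect3_up3_mult sect3_add)
qed

lemma pos_poly_sect3_Y_power: "pos_poly t (sect3 0 (Y ^ Suc n))"
proof (induction n rule: less_induct)
  case (less n)
  note intros = pos_poly.add pos_poly_numeral pos_poly_power pos_poly_mult pos_poly_self
  have t2: "pos_poly t (t\<^sup>2)"
    using pos_poly.power[of t 1] by (simp add: numeral_2_eq_2)
  have Y1: "pos_poly t (sect3 0 (Y ^ Suc 0))"
    by (simp add: sect_Y pos_poly_self)
  have Y2: "pos_poly t (sect3 0 (Y ^ Suc (Suc 0)))"
    using t2 by (simp add: sect_Y2 intros flip: power2_eq_square)
  consider "n = 0" | "n = 1" | "n = 2" | m where "n = 3 + m"
    by (metis One_nat_def Suc_1 add.commute add_2_eq_Suc' le_Suc_ex less_Suc_eq_le linorder_not_le numeral_3_eq_3 less_2_cases)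
  thus ?case
  proof cases
    \<comment> \<open>For \<open>n = 2\<close> the recursion reaches \<open>Y ^ 0\<close>, outside
      the induction hypothesis; its section is 1, and the prefactor \<open>3 * t\<close> makes the
      term admissible.\<close>
    case 3
    have "sect3 0 (Y ^ 3) = 3 * t + 3 * (t * sect3 0 (Y ^ Suc 0)) + 3 * (t * sect3 0 (Y ^ Suc (Suc 0)))"
      using sect3_Y_power_rec[of 0] sect3_up3(1)[of 1] by (simp add: algebra_simps)
    moreover have "pos_poly t \<dots>"
      using Y1 Y2 by (intro intros)
    ultimately show ?thesis using 3 by (simp add: numeral_3_eq_3)
  next
    case 4
    have "sect3 0 (Y ^ Suc n) = 3 * (t * sect3 0 (Y ^ Suc m)) + 3 * (t * sect3 0 (Y ^ Suc (Suc m)))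
        + 3 * (t * sect3 0 (Y ^ Suc (Suc (Suc m))))"
      using sect3_Y_power_rec[of "Suc m"] 4 by (simp add: algebra_simps)
    thus ?thesis using less.IH 4 by (auto intro!: intros simp del: power_Suc)
  qed (use Y1 Y2 in auto)
qed

text \<open>Powers of \<open>t\<close> are rewritten as polynomials in \<open>Y\<close>, whose
  sections are again polynomials in \<open>t\<close>.\<close>

lemma pos_poly_sect3:
  assumes "pos_poly t g"
  shows "\<exists>r. pos_poly t r \<and> sect3 0 g = 3 * r"
  using assms
proof induction
  case (power n)
  have "pos_poly Y (Y + Y\<^sup>2 + Y ^ 3)"
    using pos_poly.power[of Y 0] pos_poly.power[of Y 1] pos_poly.power[of Y 2]
    by (auto intro!: pos_poly.add simp: numeral_2_eq_2 numeral_3_eq_3)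
  hence y: "pos_poly Y (3 ^ n * (Y + Y\<^sup>2 + Y ^ 3) ^ Suc n)"
    by (intro pos_poly_numeral_power pos_poly_power)
  have sect: "pos_poly t (sect3 0 g)" if "pos_poly Y g" for g
    using that by induction (auto simp: sect3_add intro: pos_poly_sect3_Y_power pos_poly.add simp del: power_Suc)
  \<comment> \<open>One of the \<open>n + 1\<close> factors 3 is taken out as the gain; the others
    stay inside the polynomial in \<open>Y\<close>.\<close>
  have "t ^ Suc n = 3 * (3 ^ n * (Y + Y\<^sup>2 + Y ^ 3) ^ Suc n)"
    unfolding t_eq power_mult_distrib by simp
  hence "sect3 0 (t ^ Suc n) = 3 * sect3 0 (3 ^ n * (Y + Y\<^sup>2 + Y ^ 3) ^ Suc n)"
    by (simp only: sect3_0_numeral)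
  thus ?case using sect[OF y] by blast
next
  case (add g h)
  then obtain r s where "pos_poly t r" "sect3 0 g = 3 * r" "pos_poly t s" "sect3 0 h = 3 * s" by blast
  thus ?case by (intro exI[of _ "r + s"]) (simp add: sect3_add distrib_left pos_poly.add)
qed

lemma pos_poly_funpow_sect3: "\<exists>r. pos_poly t r \<and> (sect3 0 ^^ n) t = 3 ^ n * r"
proof (induction n)
  case 0
  show ?case using pos_poly_self[of t] by auto
next
  case (Suc n)
  then obtain r where r: "pos_poly t r" "(sect3 0 ^^ n) t = 3 ^ n * r" by blast
  obtain s where s: "pos_poly t s" "sect3 0 r = 3 * s" using pos_poly_sect3[OF r(1)] by blast
  have "sect3 0 (3 ^ n * r) = 3 ^ n * sect3 0 r"
    using sect3_up3_mult[of "3 ^ n" r] by simp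
  thus ?case using r s by (intro exI[of _ s]) simp
qed

end

lemma funpow_sect3_nth: "fps_nth ((sect3 0 ^^ n) g) m = fps_nth g (3 ^ n * m)"
  by (induction n arbitrary: m) (simp_all add: sect3_def mult_ac)

lemma funpow_sect3_numeral: "(sect3 0 ^^ n) (numeral w * g) = numeral w * (sect3 0 ^^ n) g"
  by (induction n) (simp_all add: sect3_0_numeral)

section \<open>The congruence\<close>

theorem theorem1p2:
  fixes \<alpha> n :: nat
  shows "(3::int) ^ (\<alpha> + 1) dvd a9 (3 ^ (\<alpha> + 1) * n + 3 ^ (\<alpha> + 1) - 1)"
proof -
  define F where "F = f 1 * f 2"
  define G where "G = f 3 * f 6"
  define B where "B = f 9 * f 18"
  have up3_F: "up3 F = G" and up3_G: "up3 G = B"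
    by (simp_all add: F_def G_def B_def up3_f)
  obtain a c where F_eq: "F = up3 a - fps_X * B - 2 * fps_X\<^sup>2 * up3 c" and ac: "a * c = G\<^sup>2"
    using f1_mult_f2_dissection unfolding F_def G_def B_def by metis
  have F_0: "F \<noteq> 0" and G_0: "G \<noteq> 0" and F_nth_0: "fps_nth F 0 = 1"
    using f_neq_0 f_nth_0[of 1] f_nth_0[of 2] by (simp_all add: F_def G_def)

  \<comment> \<open>The norm of \<open>F\<close> and its cofactor\<close>
  define N where "N = norm3 F"
  have N_mult: "N * G = F ^ 4"
  proof -
    have "N * G = (norm3 (f 1) * f 3) * (norm3 (f 2) * f 6)"
      by (simp add: N_def F_def G_def norm3_mult mult_ac)
    thus ?thesis
      using norm3_f[of 1] norm3_f[of 2] by (simp add: F_def power_mult_distrib)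
  qed
  have N_0: "N \<noteq> 0" using N_mult F_0 by auto
  have F_eq': "F = up3 a + fps_X * up3 (- G) + fps_X\<^sup>2 * up3 (- 2 * c)"
    using F_eq by (simp add: up3_G)
  have N_eq: "N = a ^ 3 - 7 * fps_X * G ^ 3 - 8 * fps_X\<^sup>2 * c ^ 3"
    using ac unfolding N_def F_eq' norm3_dissection by algebra
  have up3_ac: "up3 a * up3 c = B\<^sup>2"
    using arg_cong[OF ac, of up3] by (simp add: up3_G)
  have up3_N: "up3 N = up3 a ^ 3 - 7 * fps_X ^ 3 * B ^ 3 - 8 * fps_X ^ 6 * up3 c ^ 3"
    unfolding N_eq by (simp add: up3_G mult_ac flip: power_mult)
  \<comment> \<open>\<open>K\<close> is the product of the two other conjugates of \<open>F\<close>
    under q \<mapsto> \<omega>q, rewritten in terms of \<open>F\<close> and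
    \<open>B\<close>.\<close>
  define K where "K = F\<^sup>2 + 3 * fps_X * B * F + 9 * fps_X\<^sup>2 * B\<^sup>2"
  have F_K: "F * K = up3 N"
    unfolding K_def up3_N F_eq using up3_ac by algebra
  have up3_N_mult: "up3 N * B = G ^ 4"
    using arg_cong[OF N_mult, of up3] by (simp add: up3_G up3_F)
  define k0 where "k0 = a\<^sup>2 - 2 * fps_X * G * c"
  define k1 where "k1 = G * a + 4 * fps_X * c\<^sup>2"
  have "K = up3 a ^ 2 - 2 * fps_X ^ 3 * B * up3 c + fps_X * (B * up3 a + 4 * fps_X ^ 3 * up3 c ^ 2)
      + fps_X\<^sup>2 * (3 * B\<^sup>2)"
    unfolding K_def F_eq using up3_ac by algebra
  hence K_eq: "K = up3 k0 + fps_X * up3 k1 + fps_X\<^sup>2 * up3 (3 * G\<^sup>2)"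
    by (simp add: k0_def k1_def up3_G)
  have sect_K: "sect3 0 K = k0" "sect3 (Suc 0) K = k1" "sect3 2 K = 3 * G\<^sup>2"
    unfolding K_eq by (simp_all del: up3_simps)

  \<comment> \<open>The generating function as a quotient\<close>
  define I where "I = fps_right_inverse F 1"
  have I: "F * I = 1"
    unfolding I_def by (rule fps_right_inverse) (simp add: F_nth_0)
  have up3_I: "G * up3 I = 1"
    using arg_cong[OF I, of up3] by (simp add: up3_F)
  have a9_gf: "a9_gf = B * I"
    unfolding a9_gf_def
  proof (rule the_equality)
    show "B * I * (f 1 * f 2) = f 9 * f 18"
      using I unfolding F_def[symmetric] B_def[symmetric] by algebra
    fix A assume "A * (f 1 * f 2) = f 9 * f 18"
    thus "A = B * I"
      using I unfolding F_def[symmetric] B_def[symmetric] by (metis mult.assoc mult.right_neutral)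
  qed

  \<comment> \<open>Relations between \<open>Z\<close> and \<open>T\<close>\<close>
  define Z where "Z = fps_X * B * I"
  define T where "T = fps_X * G ^ 4 * I ^ 4"
  have up3_T: "up3 T = fps_X ^ 3 * B ^ 4 * up3 I ^ 4"
    by (simp add: T_def up3_G)
  have Z_F: "Z * F = fps_X * B"
    using I unfolding Z_def by algebra
  have T_F: "T * F ^ 4 = fps_X * G ^ 4"
    using I unfolding T_def by algebra
  have T_N: "T * N = fps_X * G ^ 3"
  proof -
    have "(T * N) * G = (fps_X * G ^ 3) * G" using T_F N_mult by algebra
    thus ?thesis using G_0 by simp
  qed
  have K_norm: "B * F * K = G ^ 4"
    using up3_N_mult by (simp add: mult.assoc F_K) (simp add: mult.commute)
  have T_up3: "up3 T * G ^ 4 = fps_X ^ 3 * B ^ 4"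
    using up3_I unfolding up3_T by algebra
  have Z_K: "(1 + 3 * Z + 9 * Z\<^sup>2) * F\<^sup>2 = K"
    using Z_F unfolding K_def by algebra
  \<comment> \<open>Clearing denominators, Z F = qB and (1 + 3Z + 9Z^2) F^2 = K reduce the claim to
    B F K = G^4.\<close>
  have T_Z: "T = Z + 3 * Z\<^sup>2 + 9 * Z ^ 3"
  proof -
    have "T * F ^ 4 = Z * (1 + 3 * Z + 9 * Z\<^sup>2) * F ^ 4"
      using T_F Z_F Z_K K_norm by algebra
    hence "T = Z * (1 + 3 * Z + 9 * Z\<^sup>2)" using F_0 by simp
    thus ?thesis by (simp add: algebra_simps power2_eq_square power3_eq_cube)
  qed
  have Z_cubed: "Z ^ 3 = up3 T * (1 + 3 * Z + 9 * Z\<^sup>2)"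
  proof -
    have "Z ^ 3 * (G ^ 4 * F ^ 3) = up3 T * (1 + 3 * Z + 9 * Z\<^sup>2) * (G ^ 4 * F ^ 3)"
      using T_up3 Z_F Z_K K_norm by algebra
    thus ?thesis using F_0 G_0 by simp
  qed
  \<comment> \<open>Multiplying by N(q^3) removes the denominator: N(q^3) Z = q B K, so only the
    third section \<open>3 * G\<^sup>2\<close> of \<open>K\<close> survives.\<close>
  have sect_Z: "sect3 0 Z = 3 * T"
  proof -
    have "up3 N * Z = up3 G * (fps_X * K)"
    proof -
      have "up3 N * Z = (Z * F) * K"
        unfolding F_K[symmetric] by (simp add: mult_ac)
      thus ?thesis
        unfolding Z_F up3_G by (simp add: mult_ac)
    qed
    hence "N * sect3 0 Z = G * (fps_X * (3 * G\<^sup>2))"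
      by (metis sect3_up3_mult sect3_0_X(1) sect_K(3))
    also have "\<dots> = N * (3 * T)" using T_N by algebra
    finally show ?thesis using N_0 by simp
  qed
  have sect_Z2: "sect3 0 (Z\<^sup>2) = 2 * T + 27 * T\<^sup>2"
  proof -
    have "up3 (N\<^sup>2) * Z\<^sup>2 = up3 (G\<^sup>2) * (fps_X\<^sup>2 * (K * K))"
    proof -
      have "up3 (N\<^sup>2) * Z\<^sup>2 = ((Z * F) * K)\<^sup>2"
        unfolding up3_simps F_K[symmetric] by algebra
      thus ?thesis
        unfolding Z_F up3_simps up3_G by algebra
    qed
    hence "N\<^sup>2 * sect3 0 (Z\<^sup>2) = G\<^sup>2 * (fps_X * sect3 (Suc 0) (K * K))"
      by (metis sect3_up3_mult sect3_0_X(2))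
    also have "sect3 (Suc 0) (K * K) = 2 * k0 * k1 + 9 * fps_X * G ^ 4"
      unfolding sect3_mult sect_K One_nat_def by algebra
    \<comment> \<open>By \<open>a * c = G\<^sup>2\<close> one has
      \<open>k0 * k1 = G * (N + 9 * fps_X * G ^ 3)\<close>, so the coefficient 27 arises as 18 +
      9.\<close>
    also have "G\<^sup>2 * (fps_X * \<dots>) = 2 * (fps_X * G ^ 3) * N + 27 * (fps_X * G ^ 3)\<^sup>2"
      unfolding k0_def k1_def N_eq using ac by algebra
    also have "\<dots> = N\<^sup>2 * (2 * T + 27 * T\<^sup>2)"
      unfolding T_N[symmetric] by algebra
    finally show ?thesis using N_0 by simp
  qed

  \<comment> \<open>Divisibility of the iterated sections\<close>
  interpret cubic_tower "3 * Z" "9 * T"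
  proof
    show "(3 * Z) ^ 3 = 3 * up3 (9 * T) * (1 + 3 * Z + (3 * Z)\<^sup>2)"
      using Z_cubed by (simp add: power_mult_distrib)
    show "9 * T = 3 * (3 * Z + (3 * Z)\<^sup>2 + (3 * Z) ^ 3)"
      unfolding T_Z by algebra
    show "sect3 0 (3 * Z) = 9 * T"
      by (simp add: sect3_0_numeral sect_Z)
    show "sect3 0 ((3 * Z)\<^sup>2) = 2 * (9 * T) + 3 * (9 * T)\<^sup>2"
      by (simp add: power_mult_distrib sect3_0_numeral sect_Z2)
  qed
  obtain r where r: "pos_poly (9 * T) r" "(sect3 0 ^^ \<alpha>) (9 * T) = 3 ^ \<alpha> * r"
    using pos_poly_funpow_sect3 by blast
  obtain s where s: "r = 9 * s"
    using pos_poly_numeral_mult[OF r(1)] .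
  \<comment> \<open>The first section gives \<open>3 * T\<close>, a third of the variable
    \<open>9 * T\<close>. The result is therefore tripled, compared with
    \<open>3 ^ \<alpha> * 9 * s\<close>, and divided by 3.\<close>
  have "(sect3 0 ^^ (\<alpha> + 1)) Z = (sect3 0 ^^ \<alpha>) (3 * T)"
    by (simp add: funpow_swap1 sect_Z)
  hence "3 * (sect3 0 ^^ (\<alpha> + 1)) Z = (sect3 0 ^^ \<alpha>) (3 * (3 * T))"
    by (simp only: funpow_sect3_numeral)
  also have "\<dots> = 3 * (3 ^ (\<alpha> + 1) * s)"
    using r(2) s by simp
  finally have *: "(sect3 0 ^^ (\<alpha> + 1)) Z = fps_const (3 ^ (\<alpha> + 1)) * s"
    by (subst (asm) mult_left_cancel) (auto simp: numeral_fps_const simp del: power_Suc)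
  \<comment> \<open>The factor \<open>fps_X\<close> in \<open>Z\<close> shifts indices by one, so
    the argument of \<open>a9\<close> is \<open>M - 1\<close> with \<open>M\<close> divisible by
    \<open>3 ^ (\<alpha> + 1)\<close>.\<close>
  define M where "M = (3::nat) ^ (\<alpha> + 1) * (n + 1)"
  have "M > 0" by (simp add: M_def)
  hence "a9 (M - 1) = fps_nth Z M"
    by (simp add: a9_def a9_gf Z_def mult.assoc)
  also have "\<dots> = fps_nth ((sect3 0 ^^ (\<alpha> + 1)) Z) (n + 1)"
    unfolding funpow_sect3_nth M_def ..
  also have "\<dots> = 3 ^ (\<alpha> + 1) * fps_nth s (n + 1)"
    unfolding * by simp
  finally show ?thesis by (simp add: M_def algebra_simps)
qed

end
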